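(* Let $d,n\geq 1$, let $(e_{k,l})_{1\leq k\leq l\leq d}$ be a fixed family of subsets of $\{1,\ldots,d\}$ satisfying the binary tree assumption (H) stated in the context, and let $Z_1,\ldots,Z_n$ be independent Bernoulli random variables with common parameter $p\in[0,1]$. Let $(A(e_{k,l}))_{1\leq k\leq l\leq d}$ and $(B(e_{k,l}))_{1\leq k\leq l\leq d}$ be two partitions of $\{1,\ldots,n\}$ indexed by this family, and for $i=1,\ldots,d$ set $$A_i:=\bigcup_{1\leq k\leq l\leq d,\ i\in e_{k,l}}A(e_{k,l}),\qquad B_i:=\bigcup_{1\leq k\leq l\leq d,\ i\in e_{k,l}}B(e_{k,l}),$$ $$X_{A_i}:=\sum_{r\in A_i}Z_r,\qquad X_{B_i}:=\sum_{r\in B_i}Z_r.$$ Then the conditions $$E[X_{A_i}]=E[X_{B_i}],\qquad 1\leq i\leq d,$$ and $$\mathrm{Cov}(X_{A_i},X_{A_j})\leq \mathrm{Cov}(X_{B_i},X_{B_j}),\qquad 1\leq i<j\leq d,$$ are (together) necessary and sufficient for the supermodular ordering $$(X_{A_1},\ldots,X_{A_d})\leq_{\rm sm}(X_{B_1},\ldots,X_{B_d}).$$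
   Context: Hypercube and order: $C_d=\{0,1\}^d$ is identified with the power set of $\{1,\ldots,d\}$ (a vector $x\in C_d$ is identified with $\{i: x_i=1\}$), ordered by inclusion. The canonical basis vector $e_k$ is identified with the singleton $\{k\}$. Assumption (H): $(e_{k,l})_{1\leq k\leq l\leq d}$ is a family of $d(d+1)/2$ pairwise distinct elements of $C_d$ with $e_{k,k}=e_k$ for $k=1,\ldots,d$ (the leaves), and, for all $1\leq k<l\leq d$, one has $k,l\in e_{k,l}$ and both sets $e_{k,l}\setminus\{k\}$ and $e_{k,l}\setminus\{l\}$ (the two children of the node $e_{k,l}$) again belong to the family. Partitions: the sets $A(e_{k,l})$, $1\leq k\leq l\leq d$, are pairwise disjoint (possibly empty) with union $\{1,\ldots,n\}$; likewise for the $B(e_{k,l})$. Supermodular order: a function $\Phi:\mathbb{R}^d\to\mathbb{R}$ is supermodular if $\Phi(x)+\Phi(y)\leq\Phi(x\wedge y)+\Phi(x\vee y)$ for all $x,y\in\mathbb{R}^d$, where $\wedge,\vee$ are the componentwise minimum and maximum. For $d$-dimensional random vectors, $X\leq_{\rm sm}Y$ means $E[\Phi(X)]\leq E[\Phi(Y)]$ for all supermodular $\Phi$ such that $\Phi(X)$ and $\Phi(Y)$ are integrable (automatic here, as the vectors take finitely many values). *)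

theory Defs
  imports "HOL-Probability.Probability"
begin

text \<open>Elements of $\{0,1\}^d$ are represented by subsets of \<open>{1..d}\<close>, and a family
  $(e_{k,l})_{1 \le k \le l \le d}$ by a function \<open>e\<close> of two indices, of which only the values
  with \<open>(k, l) \<in> tri_idx d\<close> matter.\<close>

definition tri_idx :: "nat \<Rightarrow> (nat \<times> nat) set" where
  "tri_idx d = {(k, l). 1 \<le> k \<and> k \<le> l \<and> l \<le> d}"

definition tree_family :: "nat \<Rightarrow> (nat \<Rightarrow> nat \<Rightarrow> nat set) \<Rightarrow> nat set set" where
  "tree_family d e = (\<lambda>(k, l). e k l) ` tri_idx d"

definition binary_tree_assumption :: "nat \<Rightarrow> (nat \<Rightarrow> nat \<Rightarrow> nat set) \<Rightarrow> bool" where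
  "binary_tree_assumption d e \<longleftrightarrow>
     tree_family d e \<subseteq> Pow {1..d} \<and>
     inj_on (\<lambda>(k, l). e k l) (tri_idx d) \<and>
     (\<forall>k\<in>{1..d}. e k k = {k}) \<and>
     (\<forall>k l. 1 \<le> k \<and> k < l \<and> l \<le> d \<longrightarrow>
        k \<in> e k l \<and> l \<in> e k l \<and>
        e k l - {k} \<in> tree_family d e \<and> e k l - {l} \<in> tree_family d e)"

text \<open>Blocks are indexed by the family members themselves (as in $A(e_{k,l})$) and may be empty,
  so this is not \<open>partition_on\<close>.\<close>

definition indexed_partition :: "nat set \<Rightarrow> nat set set \<Rightarrow> (nat set \<Rightarrow> nat set) \<Rightarrow> bool" where
  "indexed_partition U F A \<longleftrightarrow> disjoint_family_on A F \<and> (\<Union>S\<in>F. A S) = U"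

definition comp_set :: "nat set set \<Rightarrow> (nat set \<Rightarrow> nat set) \<Rightarrow> nat \<Rightarrow> nat set" where
  "comp_set F A i = (\<Union>S\<in>{S\<in>F. i \<in> S}. A S)"

definition bernoulli_rv :: "'a measure \<Rightarrow> real \<Rightarrow> ('a \<Rightarrow> real) \<Rightarrow> bool" where
  "bernoulli_rv M p X \<longleftrightarrow>
     X \<in> borel_measurable M \<and> distr M borel X = distr (measure_pmf (bernoulli_pmf p)) borel of_bool"

definition cov :: "'a measure \<Rightarrow> ('a \<Rightarrow> real) \<Rightarrow> ('a \<Rightarrow> real) \<Rightarrow> real" where
  "cov M X Y =
     (LINT \<omega>|M. (X \<omega> - (LINT \<omega>'|M. X \<omega>')) * (Y \<omega> - (LINT \<omega>'|M. Y \<omega>')))"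

text \<open>$\mathbb{R}^d$ is the set of extensional functions on \<open>{1..d}\<close>. It is closed under the
  pointwise \<open>inf\<close> and \<open>sup\<close> of functions, which on it are the componentwise minimum and maximum.\<close>

definition supermodular :: "nat \<Rightarrow> ((nat \<Rightarrow> real) \<Rightarrow> real) \<Rightarrow> bool" where
  "supermodular d \<Phi> \<longleftrightarrow>
     (\<forall>x \<in> {1..d} \<rightarrow>\<^sub>E UNIV. \<forall>y \<in> {1..d} \<rightarrow>\<^sub>E UNIV. \<Phi> x + \<Phi> y \<le> \<Phi> (inf x y) + \<Phi> (sup x y))"

text \<open>\<open>\<Phi>\<close> need not be measurable; \<open>integrable\<close> demands measurability of \<open>\<Phi>(X)\<close> and \<open>\<Phi>(Y)\<close>.\<close>

definition sm_le ::
  "nat \<Rightarrow> 'a measure \<Rightarrow> ('a \<Rightarrow> nat \<Rightarrow> real) \<Rightarrow> 'b measure \<Rightarrow> ('b \<Rightarrow> nat \<Rightarrow> real) \<Rightarrow> bool" where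
  "sm_le d M X N Y \<longleftrightarrow>
     (\<forall>\<Phi>. supermodular d \<Phi> \<and>
          integrable M (\<lambda>\<omega>. \<Phi> (X \<omega>)) \<and> integrable N (\<lambda>\<omega>. \<Phi> (Y \<omega>)) \<longrightarrow>
          (LINT \<omega>|M. \<Phi> (X \<omega>)) \<le> (LINT \<omega>|N. \<Phi> (Y \<omega>)))"

end

(* Identify the blocks with multisets a and b of members of the family F: block S contributes one
   copy of S per index in it, and the random vector is the sum of the indicators of these copies,
   each times its own Bernoulli variable. For 0 < p < 1 the mean and covariance conditions say that,
   for P in F, at least as many members of b as of a contain P, with equality when P is a singleton,
   because by (H) a member of F contains k and l if and only if it contains e_{k,l}.

   Replacing in b two sets S, T, where S is the union and T the intersection of U and V, by U and V
   lowers the mean of every supermodular function, and it lowers the sum of the squared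
   cardinalities. So it is enough to find, as long as a and b differ, such a transfer that preserves
   the inequalities. Take W of least cardinality with positive excess (the number of members of b
   minus the number of members of a having W as trace) and let T be W without its two ends. A set S
   of b that contains T admits a good transfer if S - T is disconnected, where members P of F inside
   S with zero excess serve as hyperedges P - T. Such an S exists: for the function that maps S to
   the number of components of S - T minus 1, the sum over b minus the sum over a is a combination
   of the excesses whose coefficients are mixed differences. These are nonnegative at each set of
   positive excess, by supermodularity of the number of components, and equal to 1 at W.

   The transfers leave F: the intermediate b consists of arbitrary subsets of members of F. *)

theory Submission
  imports Defs
begin

section \<open>Binary tree families\<close>

text \<open>Keeps the consequences of (H) that the combinatorial part uses, without the indices. In
  the last condition \<open>P\<close> is the least member containing both of its ends
  \<open>k\<close> and \<open>l\<close>; for a family satisfying (H) this is derived in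
  \<open>tree_family_least\<close>.\<close>

locale binary_tree_family =
  fixes F :: "'a set set"
  assumes finite_F: "finite F"
    and finite_member: "P \<in> F \<Longrightarrow> finite P"
    and empty_notin: "{} \<notin> F"
    and singleton_mem: "\<lbrakk>P \<in> F; i \<in> P\<rbrakk> \<Longrightarrow> {i} \<in> F"
    and ex_ends: "\<lbrakk>P \<in> F; card P \<noteq> 1\<rbrakk> \<Longrightarrow>
      \<exists>k l. k \<noteq> l \<and> k \<in> P \<and> l \<in> P \<and> P - {k} \<in> F \<and> P - {l} \<in> F \<and>
        (\<forall>Q\<in>F. k \<in> Q \<longrightarrow> l \<in> Q \<longrightarrow> P \<subseteq> Q)"
begin

definition ends :: "'a set \<Rightarrow> 'a \<Rightarrow> 'a \<Rightarrow> bool" where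
  "ends P k l \<longleftrightarrow> k \<noteq> l \<and> k \<in> P \<and> l \<in> P \<and> P - {k} \<in> F \<and> P - {l} \<in> F \<and>
    (\<forall>Q\<in>F. k \<in> Q \<longrightarrow> l \<in> Q \<longrightarrow> P \<subseteq> Q)"

lemma ends_exist: "\<lbrakk>P \<in> F; card P \<noteq> 1\<rbrakk> \<Longrightarrow> \<exists>k l. ends P k l"
  unfolding ends_def by (rule ex_ends)

lemma ends_commute: "ends P k l \<Longrightarrow> ends P l k"
  unfolding ends_def by blast

text \<open>If \<open>P\<close> is not contained in \<open>Q\<close>, then \<open>Q\<close> misses
  an end \<open>m\<close> of \<open>P\<close>, and the smaller member \<open>P - {m}\<close> has the
  same intersection with \<open>Q\<close>.\<close>

lemma Int_mem: "\<lbrakk>P \<in> F; Q \<in> F; P \<inter> Q \<noteq> {}\<rbrakk> \<Longrightarrow> P \<inter> Q \<in> F"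
proof (induction "card P" arbitrary: P rule: less_induct)
  case less
  show ?case
  proof (cases "P \<subseteq> Q")
    case True
    then show ?thesis using less.prems by (simp add: Int_absorb2)
  next
    case False
    have "card P \<noteq> 1"
    proof
      assume "card P = 1"
      then obtain i where "P = {i}" by (auto simp: card_1_singleton_iff)
      with False less.prems show False by auto
    qed
    then obtain k l where kl: "ends P k l" using ends_exist less.prems by blast
    with False less.prems(2) have "k \<notin> Q \<or> l \<notin> Q" unfolding ends_def by blast
    then obtain m where m: "m \<notin> Q" "m \<in> P" "P - {m} \<in> F" using kl unfolding ends_def by blast
    have eq: "P \<inter> Q = (P - {m}) \<inter> Q" using m by auto
    have "card (P - {m}) < card P"
      using m finite_member[OF less.prems(1)] by (meson card_Diff1_less)
    with less.hyps[of "P - {m}"] m less.prems eq show ?thesis by simp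
  qed
qed

text \<open>If \<open>k\<close> differed from both ends of \<open>P\<close>, then
  \<open>P - {k}\<close> would be a member containing both ends and hence all of
  \<open>P\<close>.\<close>

lemma ends_of_extreme:
  assumes "P \<in> F" "k \<in> P" "P - {k} \<in> F" shows "\<exists>l. ends P k l"
proof -
  have "card P \<noteq> 1" using assms empty_notin by (auto simp: card_1_singleton_iff)
  then obtain u v where uv: "ends P u v" using ends_exist assms by blast
  have "k = u \<or> k = v"
  proof (rule ccontr)
    assume "\<not> (k = u \<or> k = v)"
    then have "u \<in> P - {k}" "v \<in> P - {k}" using uv by (auto simp: ends_def)
    with uv assms(3) have "P \<subseteq> P - {k}" by (simp add: ends_def)
    with assms(2) show False by blast
  qed
  then show ?thesis
  proof
    assume "k = u" with uv show ?thesis by blast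
  next
    assume "k = v" with ends_commute[OF uv] show ?thesis by blast
  qed
qed

text \<open>\<open>P - {k, l}\<close> is the intersection of the two children of \<open>P\<close>,
  hence a member unless empty; so \<open>k\<close> is removable from \<open>P - {l}\<close>
  too.\<close>

lemma ends_child:
  assumes "ends P k l" "P \<in> F" "P - {l} \<noteq> {k}"
  shows "\<exists>m. ends (P - {l}) k m"
proof (rule ends_of_extreme)
  have "(P - {k}) \<inter> (P - {l}) \<in> F" using assms by (intro Int_mem) (auto simp: ends_def)
  moreover have "(P - {k}) \<inter> (P - {l}) = P - {l} - {k}" by auto
  ultimately show "P - {l} - {k} \<in> F" by simp
qed (use assms in \<open>auto simp: ends_def\<close>)

section \<open>Non-empty subsets of members and their hulls\<close>

definition below :: "'a set set" where
  "below = {C. C \<noteq> {} \<and> (\<exists>P\<in>F. C \<subseteq> P)}"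

text \<open>For \<open>C\<close> in \<open>below\<close> this is the least member containing
  \<open>C\<close>, by closure under non-empty intersections; if no member contains
  \<open>C\<close>, it is \<open>UNIV\<close>.\<close>

definition family_hull :: "'a set \<Rightarrow> 'a set" where
  "family_hull C = \<Inter>{Q\<in>F. C \<subseteq> Q}"

lemma belowI: "\<lbrakk>C \<noteq> {}; C \<subseteq> P; P \<in> F\<rbrakk> \<Longrightarrow> C \<in> below"
  unfolding below_def by blast

lemma below_subset: "\<lbrakk>C \<in> below; D \<subseteq> C; D \<noteq> {}\<rbrakk> \<Longrightarrow> D \<in> below"
  unfolding below_def by blast

lemma mem_below: "P \<in> F \<Longrightarrow> P \<in> below"
  using empty_notin by (intro belowI) auto

lemma finite_below: "finite below"
proof -
  have "below \<subseteq> Pow (\<Union>F)" unfolding below_def by blast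
  then show ?thesis using finite_F finite_member by (meson finite_Pow_iff finite_Union finite_subset)
qed

lemma finite_below_member: "C \<in> below \<Longrightarrow> finite C"
  unfolding below_def using finite_member finite_subset by blast

lemma family_hull_minimal: "\<lbrakk>Q \<in> F; C \<subseteq> Q\<rbrakk> \<Longrightarrow> family_hull C \<subseteq> Q"
  unfolding family_hull_def by blast

lemma subset_family_hull: "C \<subseteq> family_hull C"
  unfolding family_hull_def by blast

lemma family_hull_mem:
  assumes "C \<in> below" shows "family_hull C \<in> F"
proof -
  have *: "\<Inter>X \<in> F" if "finite X" "X \<noteq> {}" "X \<subseteq> {Q\<in>F. C \<subseteq> Q}" for X
    using that
  proof (induction X rule: finite_ne_induct)
    case (insert Q X)
    have "C \<subseteq> Q \<inter> \<Inter>X" using insert.prems by blast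
    moreover have "C \<noteq> {}" using assms unfolding below_def by blast
    ultimately have "Q \<inter> \<Inter>X \<noteq> {}" by blast
    then show ?case using insert by (auto intro!: Int_mem)
  qed auto
  show ?thesis unfolding family_hull_def
    using assms finite_F by (intro *) (auto simp: below_def)
qed

lemma family_hull_id: "P \<in> F \<Longrightarrow> family_hull P = P"
  by (simp add: family_hull_minimal subset_family_hull subset_antisym)

text \<open>If an end of the hull were not in \<open>C\<close>, removing it would give a smaller
  member that still contains \<open>C\<close>.\<close>

lemma ends_family_hull_mem:
  assumes "C \<in> below" "ends (family_hull C) k l"
  shows "k \<in> C" "l \<in> C"
proof -
  have "m \<in> C" if "m \<in> family_hull C" "family_hull C - {m} \<in> F" for m
  proof (rule ccontr)
    assume "m \<notin> C"
    then have "C \<subseteq> family_hull C - {m}" using subset_family_hull by blast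
    from family_hull_minimal[OF that(2) this] that(1) show False by blast
  qed
  then show "k \<in> C" "l \<in> C" using assms unfolding ends_def by auto
qed

lemma card_family_hull_eq_1:
  assumes "C \<in> below" shows "card (family_hull C) = 1 \<longleftrightarrow> card C = 1"
proof
  assume "card (family_hull C) = 1"
  then obtain i where "family_hull C = {i}" by (auto simp: card_1_singleton_iff)
  with subset_family_hull[of C] assms have "C = {i}" unfolding below_def by auto
  then show "card C = 1" by simp
next
  assume "card C = 1"
  then obtain i where "C = {i}" by (auto simp: card_1_singleton_iff)
  with assms singleton_mem have "C \<in> F" unfolding below_def by blast
  with \<open>card C = 1\<close> show "card (family_hull C) = 1" by (simp add: family_hull_id)
qed

lemma ends_family_hull_exist:
  assumes "C \<in> below" "card C \<noteq> 1" shows "\<exists>k l. ends (family_hull C) k l"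
  using assms card_family_hull_eq_1 family_hull_mem ends_exist by blast

section \<open>The trace basis and its coordinates\<close>

text \<open>For \<open>C \<in> F\<close> this just says \<open>C \<subseteq> S\<close>; for other \<open>C\<close> this choice makes the functions
  \<open>trace_of C\<close> satisfy the recursion below, so that they form a basis of the functions on \<open>below\<close>
  whose coordinates are mixed differences.\<close>

definition trace_of :: "'a set \<Rightarrow> 'a set \<Rightarrow> bool" where
  "trace_of C S \<longleftrightarrow> S \<inter> family_hull C = C"

lemma trace_of_mem: "P \<in> F \<Longrightarrow> trace_of P S \<longleftrightarrow> P \<subseteq> S"
  unfolding trace_of_def by (auto simp: family_hull_id)

text \<open>If the hull of \<open>C\<close> misses \<open>k\<close> or \<open>l\<close>, deleting
  that point changes no trace and the terms cancel in pairs. If it contains both, it contains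
  \<open>S\<close>, so the four traces are the four sets themselves. None of the three smaller ones
  is \<open>C\<close>, since the hull of a subset of \<open>S - {k}\<close> misses \<open>k\<close>,
  and likewise for \<open>l\<close>.\<close>

lemma trace_of_recursion:
  assumes S: "S \<in> below" and C: "C \<in> below" and kl: "ends (family_hull S) k l"
  shows "of_bool (trace_of C S) =
    of_bool (trace_of C (S - {k})) + of_bool (trace_of C (S - {l}))
      - of_bool (trace_of C (S - {k, l})) + (of_bool (S = C) :: int)"
proof -
  have kS: "k \<in> S" "l \<in> S" using ends_family_hull_mem[OF S kl] by auto
  have ne: "k \<noteq> l" using kl by (simp add: ends_def)
  have hk: "family_hull S - {k} \<in> F" "family_hull S - {l} \<in> F" using kl by (auto simp: ends_def)
  have big: "S \<subseteq> family_hull C" if "k \<in> family_hull C" "l \<in> family_hull C"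
    using kl family_hull_mem[OF C] that subset_family_hull[of S] unfolding ends_def by blast
  have nk: "k \<notin> family_hull C" if "C \<subseteq> S - {k}"
    using family_hull_minimal[OF hk(1), of C] that subset_family_hull[of S] by blast
  have nl: "l \<notin> family_hull C" if "C \<subseteq> S - {l}"
    using family_hull_minimal[OF hk(2), of C] that subset_family_hull[of S] by blast
  have CH: "C \<subseteq> family_hull C" by (rule subset_family_hull)
  show ?thesis
  proof (cases "k \<in> family_hull C"; cases "l \<in> family_hull C")
    assume "k \<in> family_hull C" "l \<in> family_hull C"
    with big have "S \<subseteq> family_hull C" by blast
    moreover have "C \<noteq> S - {k}" "C \<noteq> S - {l}" "C \<noteq> S - {k, l}"
      using nk nl \<open>k \<in> family_hull C\<close> \<open>l \<in> family_hull C\<close> by blast+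
    moreover have "S \<inter> family_hull C = S" "(S - {k}) \<inter> family_hull C = S - {k}"
      "(S - {l}) \<inter> family_hull C = S - {l}" "(S - {k,l}) \<inter> family_hull C = S - {k,l}"
      using \<open>S \<subseteq> family_hull C\<close> by blast+
    ultimately show ?thesis unfolding trace_of_def by auto
  next
    assume a: "k \<in> family_hull C" "l \<notin> family_hull C"
    have "S \<inter> family_hull C = (S - {l}) \<inter> family_hull C" "(S - {k}) \<inter> family_hull C = (S - {k,l}) \<inter> family_hull C"
      "S \<noteq> C" using a CH kS by blast+
    then show ?thesis unfolding trace_of_def by simp
  next
    assume a: "k \<notin> family_hull C" "l \<in> family_hull C"
    have "S \<inter> family_hull C = (S - {k}) \<inter> family_hull C" "(S - {l}) \<inter> family_hull C = (S - {k,l}) \<inter> family_hull C"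
      "S \<noteq> C" using a CH kS by blast+
    then show ?thesis unfolding trace_of_def by simp
  next
    assume a: "k \<notin> family_hull C" "l \<notin> family_hull C"
    have "S \<inter> family_hull C = (S - {k}) \<inter> family_hull C" "(S - {l}) \<inter> family_hull C = (S - {k}) \<inter> family_hull C"
      "(S - {k,l}) \<inter> family_hull C = (S - {k}) \<inter> family_hull C"
      "S \<noteq> C" using a CH kS by blast+
    then show ?thesis unfolding trace_of_def by simp
  qed
qed

text \<open>By \<open>ends_of_extreme\<close> the two ends are unique up to order, and
  \<open>mixed_diff\<close> is symmetric in them, so the choice does not affect it.\<close>

definition end_pair :: "'a set \<Rightarrow> 'a \<times> 'a" where
  "end_pair C = (SOME (k, l). ends (family_hull C) k l)"

definition mixed_diff :: "('a set \<Rightarrow> int) \<Rightarrow> 'a set \<Rightarrow> int" where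
  "mixed_diff h C = (if card C = 1 then h C
    else (case end_pair C of (k, l) \<Rightarrow> h C - h (C - {k}) - h (C - {l}) + h (C - {k, l})))"

lemma ends_end_pair:
  assumes "C \<in> below" "card C \<noteq> 1" "end_pair C = (k, l)"
  shows "ends (family_hull C) k l"
proof -
  from ends_family_hull_exist[OF assms(1,2)] obtain u v where "ends (family_hull C) u v" by blast
  then have "case (u, v) of (k, l) \<Rightarrow> ends (family_hull C) k l" by simp
  then have "case end_pair C of (k, l) \<Rightarrow> ends (family_hull C) k l"
    unfolding end_pair_def by (rule someI[where P="\<lambda>(k, l). ends (family_hull C) k l"])
  with assms(3) show ?thesis by simp
qed

text \<open>Both sides obey the same recursion over the ends of the hull of \<open>S\<close>: on the
  right it is \<open>trace_of_recursion\<close>, whose additional term contributes exactly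
  \<open>mixed_diff h S\<close>. On a singleton \<open>S\<close> only the basis function of
  \<open>S\<close> itself is nonzero.\<close>

lemma expansion:
  assumes "h {} = 0"
  shows "S = {} \<or> S \<in> below \<Longrightarrow>
    h S = (\<Sum>C\<in>below. mixed_diff h C * of_bool (trace_of C S))"
proof (induction "card S" arbitrary: S rule: less_induct)
  case less
  show ?case
  proof (cases "S = {}")
    case True
    have "\<not> trace_of C {}" if "C \<in> below" for C
      using that unfolding trace_of_def below_def by auto
    then show ?thesis using True assms by simp
  next
    case False
    with less have S: "S \<in> below" by blast
    have fS: "finite S" using S finite_below_member by blast
    have del: "(\<Sum>C\<in>below. mixed_diff h C * of_bool (S = C)) = mixed_diff h S"
      using S finite_below by (subst sum.remove[of _ S]) (auto intro!: sum.neutral)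
    show ?thesis
    proof (cases "card S = 1")
      case True
      have "trace_of C S \<longleftrightarrow> S = C" if "C \<in> below" for C
      proof -
        have "C \<noteq> {}" using that unfolding below_def by blast
        obtain i where i: "S = {i}" using True by (auto simp: card_1_singleton_iff)
        have "{i} \<in> F" using S i singleton_mem unfolding below_def by blast
        then have "family_hull {i} = {i}" by (rule family_hull_id)
        with i \<open>C \<noteq> {}\<close> show ?thesis unfolding trace_of_def by auto
      qed
      then have "(\<Sum>C\<in>below. mixed_diff h C * of_bool (trace_of C S)) = mixed_diff h S"
        using del by simp
      then show ?thesis using True by (simp add: mixed_diff_def)
    next
      case False
      obtain k l where p: "end_pair S = (k, l)" by fastforce
      have kl: "ends (family_hull S) k l" using ends_end_pair[OF S False p] .
      have kS: "k \<in> S" "l \<in> S" using ends_family_hull_mem[OF S kl] by auto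
      have IH: "h (S - X) = (\<Sum>C\<in>below. mixed_diff h C * of_bool (trace_of C (S - X)))"
        if "X \<inter> S \<noteq> {}" for X
      proof (rule less.hyps)
        show "card (S - X) < card S" using that fS by (intro psubset_card_mono) auto
        show "S - X = {} \<or> S - X \<in> below" using below_subset[OF S, of "S - X"] by auto
      qed
      have "(\<Sum>C\<in>below. mixed_diff h C * of_bool (trace_of C S)) =
        (\<Sum>C\<in>below. mixed_diff h C * of_bool (trace_of C (S - {k}))
          + mixed_diff h C * of_bool (trace_of C (S - {l}))
          - mixed_diff h C * of_bool (trace_of C (S - {k, l}))
          + mixed_diff h C * of_bool (S = C))"
        by (intro sum.cong refl)
          (simp only: trace_of_recursion[OF S _ kl] distrib_left right_diff_distrib)
      also have "\<dots> = h (S - {k}) + h (S - {l}) - h (S - {k, l}) + mixed_diff h S"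
      proof -
        have ne: "{k} \<inter> S \<noteq> {}" "{l} \<inter> S \<noteq> {}" "{k, l} \<inter> S \<noteq> {}" using kS by auto
        show ?thesis
          by (simp only: sum.distrib sum_subtractf IH[OF ne(1)] IH[OF ne(2)] IH[OF ne(3)] del)
      qed
      also have "\<dots> = h S" using False p by (simp add: mixed_diff_def)
      finally show ?thesis by simp
    qed
  qed
qed

definition trace_count :: "'a set multiset \<Rightarrow> 'a set \<Rightarrow> int" where
  "trace_count b C = (\<Sum>S\<in>#b. of_bool (trace_of C S))"

lemma expansion_mset:
  assumes "h {} = 0" "set_mset b \<subseteq> below"
  shows "(\<Sum>S\<in>#b. h S) = (\<Sum>C\<in>below. mixed_diff h C * trace_count b C)"
  using assms(2)
proof (induction b)
  case (add S b)
  then show ?case using expansion[of h S] assms(1)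
    by (simp add: trace_count_def distrib_left sum.distrib)
qed (simp add: trace_count_def)

end

section \<open>Components of hypergraphs\<close>

text \<open>The closure is reflexive, so a vertex lying in no hyperedge forms a component of its
  own.\<close>

definition component :: "'a set set \<Rightarrow> 'a \<Rightarrow> 'a set" where
  "component E v = (\<Union>X\<in>E. X \<times> X)\<^sup>* `` {v}"

definition num_components :: "'a set \<Rightarrow> 'a set set \<Rightarrow> nat" where
  "num_components D E = card (component E ` D)"

lemma linked_sym: "(x, y) \<in> (\<Union>X\<in>E. X \<times> X)\<^sup>* \<Longrightarrow> (y, x) \<in> (\<Union>X\<in>E. X \<times> X)\<^sup>*"
proof -
  have "sym (\<Union>X\<in>E. X \<times> X)" by (auto simp: sym_def)
  then show "(x, y) \<in> (\<Union>X\<in>E. X \<times> X)\<^sup>* \<Longrightarrow> ?thesis" using sym_rtrancl by (metis symD)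
qed

lemma component_refl: "v \<in> component E v"
  by (simp add: component_def)

lemma component_eq: "w \<in> component E v \<Longrightarrow> component E w = component E v"
  unfolding component_def by (auto dest: linked_sym elim: rtrancl_trans)

lemma component_sym: "w \<in> component E v \<Longrightarrow> v \<in> component E w"
  unfolding component_def by (auto dest: linked_sym)

lemma component_edge: "\<lbrakk>X \<in> E; x \<in> X; y \<in> X\<rbrakk> \<Longrightarrow> y \<in> component E x"
  unfolding component_def by (auto)

lemma component_mono: "E \<subseteq> E' \<Longrightarrow> component E v \<subseteq> component E' v"
  unfolding component_def by (intro Image_mono rtrancl_mono) auto

lemma component_least:
  assumes "v \<in> K" "\<And>X x. \<lbrakk>X \<in> E; x \<in> X; x \<in> K\<rbrakk> \<Longrightarrow> X \<subseteq> K"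
  shows "component E v \<subseteq> K"
proof
  fix w assume "w \<in> component E v"
  then have "(v, w) \<in> (\<Union>X\<in>E. X \<times> X)\<^sup>*" by (simp add: component_def)
  then show "w \<in> K"
  proof (induction rule: rtrancl_induct)
    case (step y z)
    then show ?case using assms(2) by blast
  qed (rule assms(1))
qed

lemma component_insert:
  "component (insert X E) v =
    (if component E v \<inter> X = {} then component E v else (\<Union>x\<in>X. component E x))"
proof (cases "component E v \<inter> X = {}")
  case True
  have "component (insert X E) v \<subseteq> component E v"
  proof (rule component_least)
    fix Y y assume "Y \<in> insert X E" "y \<in> Y" "y \<in> component E v"
    with True show "Y \<subseteq> component E v"
      using component_edge component_eq by (metis disjoint_iff insertE subsetI)
  qed (rule component_refl)
  with True component_mono[of E "insert X E" v] show ?thesis by auto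
next
  case False
  then obtain x where x: "x \<in> X" "x \<in> component E v" by blast
  have "component (insert X E) v \<subseteq> (\<Union>x\<in>X. component E x)"
  proof (rule component_least)
    show "v \<in> (\<Union>x\<in>X. component E x)" using x component_sym by fast
    fix Y y assume *: "Y \<in> insert X E" "y \<in> Y" "y \<in> (\<Union>x\<in>X. component E x)"
    show "Y \<subseteq> (\<Union>x\<in>X. component E x)"
    proof (cases "Y = X")
      case True then show ?thesis using component_refl by fast
    next
      case False
      then have "Y \<in> E" using * by blast
      then have "Y \<subseteq> component E y" using component_edge * by fast
      with * show ?thesis using component_eq by fast
    qed
  qed
  moreover have "(\<Union>x\<in>X. component E x) \<subseteq> component (insert X E) v"
  proof
    fix w assume "w \<in> (\<Union>x\<in>X. component E x)"
    then obtain y where y: "y \<in> X" "w \<in> component E y" by blast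
    have 1: "x \<in> component (insert X E) v" using x component_mono[of E "insert X E" v] by blast
    have 2: "y \<in> component (insert X E) x" using x y by (intro component_edge[of X]) auto
    have 3: "w \<in> component (insert X E) y" using y component_mono[of E "insert X E" y] by blast
    show "w \<in> component (insert X E) v"
      using component_eq[OF 1] component_eq[OF 2] 3 by simp
  qed
  ultimately show ?thesis using False by auto
qed

text \<open>The components that \<open>X\<close> meets merge into the single component
  \<open>M\<close>, while the others, collected in \<open>N\<close>, stay as they are. The additive
  form avoids subtraction of natural numbers.\<close>

lemma num_components_insert:
  assumes "finite D" "X \<subseteq> D" "X \<noteq> {}"
  shows "num_components D (insert X E) + card (component E ` X) = num_components D E + 1"
proof -
  define N where "N = component E ` {v\<in>D. component E v \<inter> X = {}}"
  define M where "M = (\<Union>x\<in>X. component E x)"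
  have fin: "finite N" "finite (component E ` X)"
    using assms finite_subset unfolding N_def by auto
  obtain x where x: "x \<in> X" using assms by blast
  have disj: "Y \<inter> X = {}" if "Y \<in> N" for Y using that unfolding N_def by auto
  have xM: "x \<in> M" using x component_refl unfolding M_def by fast
  have "component (insert X E) ` D = insert M N"
  proof (intro subset_antisym subsetI)
    fix Y assume "Y \<in> component (insert X E) ` D"
    then show "Y \<in> insert M N" unfolding M_def N_def by (auto simp: component_insert)
  next
    fix Y assume Y: "Y \<in> insert M N"
    show "Y \<in> component (insert X E) ` D"
    proof (cases "Y = M")
      case True
      have "component (insert X E) x = M"
        using x component_refl[of x E] unfolding M_def component_insert by auto
      with True x assms show ?thesis by blast
    next
      case False
      with Y obtain v where "v \<in> D" "component E v \<inter> X = {}" "Y = component E v"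
        unfolding N_def by blast
      then show ?thesis by (intro image_eqI[of _ _ v]) (auto simp: component_insert)
    qed
  qed
  moreover have "M \<notin> N" using disj xM x by blast
  ultimately have 1: "num_components D (insert X E) = card N + 1"
    using fin by (simp add: num_components_def)
  have "component E ` D = N \<union> component E ` X"
  proof (intro subset_antisym subsetI)
    fix Y assume "Y \<in> component E ` D"
    then obtain v where v: "v \<in> D" "Y = component E v" by blast
    show "Y \<in> N \<union> component E ` X"
    proof (cases "component E v \<inter> X = {}")
      case False
      then obtain y where "y \<in> X" "y \<in> component E v" by blast
      then show ?thesis using v component_eq[of y E v] by blast
    qed (use v N_def in auto)
  qed (use assms N_def in auto)
  moreover have "N \<inter> component E ` X = {}"
  proof -
    have "Y \<inter> X \<noteq> {}" if "Y \<in> component E ` X" for Y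
    proof -
      from that obtain x where "x \<in> X" "Y = component E x" by blast
      with component_refl[of x E] show ?thesis by auto
    qed
    with disj show ?thesis by blast
  qed
  ultimately have "num_components D E = card N + card (component E ` X)"
    using fin by (simp add: num_components_def card_Un_disjoint)
  with 1 show ?thesis by simp
qed

text \<open>The component of \<open>x\<close> under the larger \<open>E'\<close> is determined by
  its component under \<open>E\<close>, so the components for \<open>E'\<close> are the image of
  those for \<open>E\<close> under a map.\<close>

lemma card_component_antimono:
  assumes "E \<subseteq> E'" "finite X"
  shows "card (component E' ` X) \<le> card (component E ` X)"
proof -
  have *: "component E' x = (\<Union>y\<in>component E x. component E' y)" for x
  proof -
    have "component E' y = component E' x" if "y \<in> component E x" for y
      using that component_mono[OF assms(1), of x] by (intro component_eq) blast
    then have "(\<Union>y\<in>component E x. component E' y) = (\<Union>y\<in>component E x. component E' x)"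
      by simp
    then show ?thesis using component_refl[of x E] by auto
  qed
  have "component E' ` X = (\<lambda>Y. \<Union>y\<in>Y. component E' y) ` component E ` X"
    unfolding image_image by (intro image_cong refl *)
  then show ?thesis using assms(2) by (metis card_image_le finite_imageI)
qed

text \<open>Adding one hyperedge lowers the number of components by the number it meets minus 1. By
  \<open>card_component_antimono\<close> this drop is no larger over \<open>E'\<close> than over
  \<open>E\<close>; the elements of \<open>G\<close> are added one at a time.\<close>

lemma num_components_supermodular:
  assumes "finite D" "E \<subseteq> E'" "finite G" "\<And>X. X \<in> G \<Longrightarrow> X \<subseteq> D \<and> X \<noteq> {}"
  shows "num_components D (E \<union> G) + num_components D E'
    \<le> num_components D (E' \<union> G) + num_components D E"
  using assms(3,4)
proof (induction G)
  case (insert X G)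
  have "card (component (E' \<union> G) ` X) \<le> card (component (E \<union> G) ` X)"
    using assms(1,2) insert.prems[of X] by (intro card_component_antimono) (auto intro: finite_subset)
  moreover have "num_components D (insert X (E \<union> G)) + card (component (E \<union> G) ` X)
      = num_components D (E \<union> G) + 1"
    "num_components D (insert X (E' \<union> G)) + card (component (E' \<union> G) ` X)
      = num_components D (E' \<union> G) + 1"
    using insert.prems[of X] num_components_insert[OF assms(1)] by simp_all
  ultimately show ?case using insert by simp
qed auto

lemma component_isolated: "v \<notin> \<Union>E \<Longrightarrow> component E v = {v}"
  using component_least[of v "{v}" E] component_refl[of v E] by blast

text \<open>The vertices of \<open>D - D'\<close> are isolated. This allows hypergraphs on different
  vertex sets to be compared on a common one.\<close>

lemma num_components_extend:
  assumes "finite D" "D' \<subseteq> D" "\<Union>E \<subseteq> D'"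
  shows "num_components D E = num_components D' E + card (D - D')"
proof -
  have "component E v = {v}" if "v \<in> D - D'" for v
    using that assms(3) by (intro component_isolated) blast
  then have 1: "component E ` (D - D') = (\<lambda>v. {v}) ` (D - D')"
    by simp
  have "component E ` D = component E ` D' \<union> component E ` (D - D')"
    using assms(2) by blast
  moreover have "component E ` D' \<inter> component E ` (D - D') = {}"
  proof -
    have "component E v \<subseteq> D'" if "v \<in> D'" for v
      using that assms(3) by (intro component_least) auto
    then show ?thesis unfolding 1 by auto
  qed
  moreover have "card ((\<lambda>v. {v}) ` (D - D')) = card (D - D')"
    by (intro card_image) auto
  ultimately show ?thesis using assms finite_subset unfolding num_components_def
    by (metis (no_types, lifting) 1 card_Un_disjoint finite_Diff finite_imageI)
qed

lemma num_components_discrete: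
  assumes "\<And>X. X \<in> E \<Longrightarrow> \<exists>x. X \<subseteq> {x}"
  shows "num_components D E = card D"
proof -
  have "component E v = {v}" for v
  proof -
    have "component E v \<subseteq> {v}" using assms by (intro component_least) auto
    with component_refl[of v E] show ?thesis by auto
  qed
  then show ?thesis by (simp add: num_components_def card_image)
qed

lemma num_components_le_1:
  assumes "\<And>x y. \<lbrakk>x \<in> D; y \<in> D\<rbrakk> \<Longrightarrow> y \<in> component E x"
  shows "num_components D E \<le> 1"
proof (cases "D = {}")
  case False
  then obtain x where "x \<in> D" by blast
  with assms component_eq have "component E ` D = {component E x}" by fast
  then show ?thesis by (simp add: num_components_def)
qed (simp add: num_components_def)

lemma num_components_pos: "\<lbrakk>finite D; D \<noteq> {}\<rbrakk> \<Longrightarrow> num_components D E \<ge> 1"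
  by (simp add: num_components_def Suc_le_eq card_gt_0_iff)

section \<open>Existence of a transfer\<close>

text \<open>Transfers change only \<open>b\<close>, so \<open>a\<close> may be required to stay
  inside \<open>F\<close>. The inequality is assumed on \<open>F\<close> only; it extends to
  \<open>below\<close> because \<open>trace_count a\<close> vanishes outside
  \<open>F\<close>.\<close>

locale dominated_family = binary_tree_family F for F :: "'a set set" +
  fixes a b :: "'a set multiset"
  assumes a_sub: "set_mset a \<subseteq> F"
    and b_sub: "set_mset b \<subseteq> below"
    and trace_count_le: "P \<in> F \<Longrightarrow> trace_count a P \<le> trace_count b P"
    and trace_count_singleton: "{i} \<in> F \<Longrightarrow> trace_count a {i} = trace_count b {i}"
begin

definition excess :: "'a set \<Rightarrow> int" where
  "excess C = trace_count b C - trace_count a C"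

lemma trace_count_nonneg: "0 \<le> trace_count c C"
  unfolding trace_count_def by (induction c) auto

lemma trace_count_pos_iff: "0 < trace_count c C \<longleftrightarrow> (\<exists>S\<in>#c. trace_of C S)"
proof (induction c)
  case (add S c)
  have "0 \<le> trace_count c C" by (rule trace_count_nonneg)
  with add show ?case by (auto simp: trace_count_def)
qed (simp add: trace_count_def)

text \<open>The trace of a member on a hull is an intersection of two members, hence a member if it
  is non-empty.\<close>

lemma trace_count_a_eq_0:
  assumes "C \<in> below" "C \<notin> F" shows "trace_count a C = 0"
proof (rule ccontr)
  assume "trace_count a C \<noteq> 0"
  then have "0 < trace_count a C" using trace_count_nonneg[of a C] by simp
  then obtain S where S: "S \<in># a" "S \<inter> family_hull C = C"
    unfolding trace_count_pos_iff trace_of_def by blast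
  have "S \<inter> family_hull C \<in> F"
    using S a_sub assms family_hull_mem by (intro Int_mem) (auto simp: below_def)
  with S assms show False by simp
qed

lemma excess_nonneg: "C \<in> below \<Longrightarrow> 0 \<le> excess C"
  unfolding excess_def using trace_count_le trace_count_a_eq_0 trace_count_nonneg[of b C]
  by (cases "C \<in> F") auto

lemma excess_singleton: "{i} \<in> below \<Longrightarrow> excess {i} = 0"
  unfolding excess_def using trace_count_singleton singleton_mem by (auto simp: below_def)

lemma excess_card_1: "\<lbrakk>C \<in> below; card C = 1\<rbrakk> \<Longrightarrow> excess C = 0"
  using excess_singleton by (auto simp: card_1_singleton_iff)

lemma excess_pos_imp:
  assumes "0 < excess C" shows "\<exists>S\<in>#b. S \<inter> family_hull C = C"
proof -
  have "0 < trace_count b C" using assms trace_count_nonneg[of a C] unfolding excess_def by simp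
  then show ?thesis unfolding trace_count_pos_iff trace_of_def .
qed

lemma sum_diff_eq:
  assumes "h {} = 0"
  shows "(\<Sum>S\<in>#b. h S) = (\<Sum>S\<in>#a. h S) + (\<Sum>C\<in>below. mixed_diff h C * excess C)"
proof -
  have "set_mset a \<subseteq> below" using a_sub mem_below by blast
  from expansion_mset[of h, OF assms this] expansion_mset[of h, OF assms b_sub]
  show ?thesis unfolding excess_def by (simp add: right_diff_distrib sum_subtractf)
qed

lemma sum_mset_of_bool_eq: "(\<Sum>S\<in>#c. of_bool (S = X)) = int (count c X)"
  by (induction c) auto

text \<open>Expanding the indicator function of \<open>X\<close> compares the multiplicities of
  \<open>X\<close>. The empty set is treated apart because the expansion requires
  \<open>h {} = 0\<close>.\<close>

lemma eq_if_excess_eq_0: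
  assumes "\<And>C. C \<in> below \<Longrightarrow> excess C = 0" shows "a = b"
proof (rule multiset_eqI)
  fix X
  show "count a X = count b X"
  proof (cases "X = {}")
    case True
    have "{} \<notin># a" "{} \<notin># b" using a_sub b_sub empty_notin by (auto simp: below_def)
    then show ?thesis using True by (simp add: not_in_iff)
  next
    case False
    then show ?thesis
      using sum_diff_eq[of "\<lambda>S. of_bool (S = X)"] assms by (simp add: sum_mset_of_bool_eq)
  qed
qed

end

section \<open>A transfer from a set of least cardinality with positive excess\<close>

locale minimal_excess = dominated_family F a b for F :: "'a set set" and a b +
  fixes W :: "'a set" and x y :: 'a
  assumes W_below: "W \<in> below" and W_excess: "0 < excess W"
    and W_min: "\<lbrakk>C \<in> below; card C < card W\<rbrakk> \<Longrightarrow> excess C = 0"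
    and end_pair_W: "end_pair W = (x, y)"
begin

definition T :: "'a set" where "T = W - {x, y}"

definition tight :: "'a set set" where
  "tight = {P\<in>F. excess P = 0}"

definition edges :: "'a set \<Rightarrow> 'a set set" where
  "edges Q = (\<lambda>P. P - T) ` {P\<in>tight. P \<subseteq> Q \<and> \<not> P \<subseteq> T}"

text \<open>The value at \<open>Q = T\<close> is 0, whereas the formula for larger sets would give
  -1 there. This keeps \<open>splits\<close> nonnegative on \<open>below\<close>, makes it vanish at
  the empty set, and yields mixed difference 1 at \<open>W\<close>.\<close>

definition splits :: "'a set \<Rightarrow> int" where
  "splits Q = (if T \<subset> Q then int (num_components (Q - T) (edges Q)) - 1 else 0)"

lemma card_W: "card W \<noteq> 1"
  using W_excess excess_card_1[OF W_below] by auto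

lemma ends_W: "ends (family_hull W) x y"
  using ends_end_pair[OF W_below card_W end_pair_W] .

lemma xy: "x \<in> W" "y \<in> W" "x \<noteq> y"
  using ends_family_hull_mem[OF W_below ends_W] ends_W by (auto simp: ends_def)

lemma finite_T: "finite T"
  using finite_below_member[OF W_below] by (simp add: T_def)

lemma card_W_eq: "card W = card T + 2"
proof -
  have "W = insert x (insert y T)" using xy by (auto simp: T_def)
  moreover have "x \<notin> insert y T" "y \<notin> T" using xy by (auto simp: T_def)
  ultimately show ?thesis using finite_T by (metis add_2_eq_Suc' card_insert_disjoint finite_insert)
qed

text \<open>The hull of \<open>S \<inter> Q\<close> lies in \<open>Q\<close>, so \<open>S\<close>
  has this set as trace and \<open>b\<close> counts it. Its excess is 0 by minimality of
  \<open>W\<close>, so \<open>a\<close> counts it too, which by \<open>trace_count_a_eq_0\<close>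
  forces it into \<open>F\<close>.\<close>

lemma small_trace:
  assumes "S \<in># b" "Q \<in> F" "S \<inter> Q \<noteq> {}" "card (S \<inter> Q) < card W"
  shows "S \<inter> Q \<in> tight"
proof -
  let ?C = "S \<inter> Q"
  have C: "?C \<in> below" using assms by (intro belowI[of _ Q]) auto
  have "family_hull ?C \<subseteq> Q" using assms by (intro family_hull_minimal) auto
  then have "trace_of ?C S" using subset_family_hull[of ?C] unfolding trace_of_def by blast
  then have "0 < trace_count b ?C" using assms trace_count_pos_iff by blast
  moreover have "excess ?C = 0" using W_min[OF C] assms by blast
  ultimately show ?thesis using trace_count_a_eq_0[OF C] unfolding tight_def excess_def by auto
qed

text \<open>\<open>W\<close> itself need not belong to \<open>F\<close>.\<close>

lemma W_Diff_mem: "W - {x} \<in> F" "W - {y} \<in> F"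
proof -
  obtain S where S: "S \<in># b" "S \<inter> family_hull W = W" using excess_pos_imp[OF W_excess] by blast
  have fW: "finite W" using finite_below_member[OF W_below] .
  have "W - {z} \<in> F" if z: "z \<in> {x, y}" for z
  proof -
    have "S \<inter> (family_hull W - {z}) = W - {z}" using S by blast
    moreover have "card (W - {z}) < card W" using z xy fW by (intro card_Diff1_less) auto
    moreover have "family_hull W - {z} \<in> F" using z ends_W by (auto simp: ends_def)
    moreover have "W - {z} \<noteq> {}" using xy z by auto
    ultimately show ?thesis using small_trace[of S "family_hull W - {z}"] S by (auto simp: tight_def)
  qed
  then show "W - {x} \<in> F" "W - {y} \<in> F" by auto
qed

lemma T_mem: "T \<noteq> {} \<Longrightarrow> T \<in> F"
proof -
  assume "T \<noteq> {}"
  moreover have "T = (W - {x}) \<inter> (W - {y})" by (auto simp: T_def)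
  ultimately show ?thesis using Int_mem[OF W_Diff_mem] by simp
qed

lemma large_if_excess: "\<lbrakk>C \<in> below; 0 < excess C\<rbrakk> \<Longrightarrow> card T + 2 \<le> card C"
  using W_min[of C] card_W_eq by (metis less_irrefl not_le)

text \<open>Expand the indicator function of \<open>T\<close>. A set \<open>C\<close> of positive
  excess has at least \<open>card T + 2\<close> elements, so only \<open>C\<close> without both ends
  can equal \<open>T\<close>. Hence the mixed differences at such sets are 0 or 1, and the one at
  \<open>W\<close> is 1.\<close>

lemma T_in_b: "T \<noteq> {} \<Longrightarrow> T \<in># b"
proof -
  assume ne: "T \<noteq> {}"
  let ?h = "\<lambda>S. of_bool (S = T) :: int"
  have ge: "mixed_diff ?h C = of_bool (snd (end_pair C) \<noteq> fst (end_pair C)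
      \<and> C - {fst (end_pair C), snd (end_pair C)} = T)"
    if C: "C \<in> below" "0 < excess C" for C
  proof -
    have c: "card T + 2 \<le> card C" using large_if_excess[OF C] .
    then have c1: "card C \<noteq> 1" by simp
    obtain k l where kl: "end_pair C = (k, l)" by fastforce
    have "ends (family_hull C) k l" using ends_end_pair[OF C(1) c1 kl] .
    then have "k \<noteq> l" by (simp add: ends_def)
    have "C \<noteq> T" using c by auto
    moreover have "C - {z} \<noteq> T" for z
      using c by (metis Suc_n_not_le_n add_2_eq_Suc' card_Diff_singleton_if
          le_SucI le_diff_conv Suc_eq_plus1 not_less_eq_eq)
    ultimately show ?thesis using c1 kl \<open>k \<noteq> l\<close> by (simp add: mixed_diff_def)
  qed
  have nn: "0 \<le> mixed_diff ?h C * excess C" if C: "C \<in> below" for C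
  proof (cases "excess C = 0")
    case False
    then have "0 < excess C" using excess_nonneg[OF C] by simp
    with ge[OF C this] show ?thesis by simp
  qed simp
  have "mixed_diff ?h W = 1" using ge[OF W_below W_excess] end_pair_W xy by (simp add: T_def)
  then have "0 < (\<Sum>C\<in>below. mixed_diff ?h C * excess C)"
    using nn W_below W_excess finite_below by (intro sum_pos2[of _ W]) auto
  moreover have "0 \<le> (\<Sum>S\<in>#a. ?h S)" unfolding sum_mset_of_bool_eq by simp
  ultimately have "0 < (\<Sum>S\<in>#b. ?h S)" using sum_diff_eq[of ?h] ne by simp
  then show ?thesis unfolding sum_mset_of_bool_eq by simp
qed

lemma edges_mono: "Q \<subseteq> Q' \<Longrightarrow> edges Q \<subseteq> edges Q'"
  unfolding edges_def by blast

lemma edges_subset: "X \<in> edges Q \<Longrightarrow> X \<subseteq> Q - T \<and> X \<noteq> {}"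
  unfolding edges_def by blast

lemma finite_edges: "finite (edges Q)"
  unfolding edges_def tight_def using finite_F by simp

text \<open>Removing the end of \<open>X\<close> other than \<open>m\<close> shrinks the trace on \<open>S\<close> by at most one element and
  keeps \<open>m\<close> an end.\<close>

lemma descend:
  assumes "X \<in> F" "m \<in> X" "X = {m} \<or> X - {m} \<in> F" "m \<in> S" "1 \<le> n" "n \<le> card (X \<inter> S)"
  shows "\<exists>Q\<in>F. m \<in> Q \<and> Q \<subseteq> X \<and> card (Q \<inter> S) = n"
  using assms
proof (induction "card X" arbitrary: X rule: less_induct)
  case less
  show ?case
  proof (cases "card (X \<inter> S) = n")
    case False
    have "X \<noteq> {m}" using False less.prems by auto
    then obtain z where z: "ends X m z" using ends_of_extreme less.prems by blast
    have fX: "finite X" using finite_member less.prems by blast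
    have zX: "z \<in> X" "m \<noteq> z" "X - {z} \<in> F" using z by (auto simp: ends_def)
    have "X - {z} = {m} \<or> X - {z} - {m} \<in> F"
      using ends_child[OF z less.prems(1)] by (auto simp: ends_def)
    moreover have "n \<le> card ((X - {z}) \<inter> S)"
    proof -
      have "(X - {z}) \<inter> S = X \<inter> S - {z}" by blast
      then show ?thesis
        using False less.prems(6) diff_card_le_card_Diff[of "{z}" "X \<inter> S"] by simp
    qed
    moreover have "card (X - {z}) < card X" using fX zX by (intro card_Diff1_less) auto
    ultimately obtain Q where "Q \<in> F" "m \<in> Q" "Q \<subseteq> X - {z}" "card (Q \<inter> S) = n"
      using less.hyps[of "X - {z}"] zX less.prems by auto
    then show ?thesis by blast
  qed (use less.prems in blast)
qed

text \<open>Induction on \<open>U\<close>, peeling off the end \<open>m\<close> opposite to \<open>k\<close>. If \<open>m \<in> S\<close>, a member of \<open>F\<close> inside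
  \<open>U - {k}\<close> whose trace on \<open>S\<close> contains \<open>m\<close> and has \<open>card T + 1\<close> elements is tight by minimality of
  \<open>W\<close>; as it misses \<open>k \<in> T\<close>, it links \<open>m\<close> to another element outside \<open>T\<close>.\<close>

lemma trace_connected:
  assumes S: "S \<in># b" "T \<subseteq> S" "k \<in> T"
  shows "\<lbrakk>U \<in> F; T \<subseteq> U; U = {k} \<or> U - {k} \<in> F; u \<in> S \<inter> U - T; v \<in> S \<inter> U - T\<rbrakk>
    \<Longrightarrow> v \<in> component (edges (S \<inter> U)) u"
proof (induction "card U" arbitrary: U u v rule: less_induct)
  case less
  have TF: "T \<in> F" using S T_mem by blast
  have fU: "finite U" using finite_member less.prems by blast
  have kU: "k \<in> U" using S less.prems by blast
  have "U \<noteq> {k}" using less.prems S by auto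
  then obtain m where m: "ends U k m" using ends_of_extreme[of U k] less.prems kU by blast
  have mU: "m \<in> U" "k \<noteq> m" "U - {m} \<in> F" "U - {k} \<in> F" using m by (auto simp: ends_def)
  have mT: "m \<notin> T"
  proof
    assume "m \<in> T"
    with m TF S have "U \<subseteq> T" by (auto simp: ends_def)
    with less.prems show False by blast
  qed
  let ?U = "U - {m}"
  have "card ?U < card U" using fU mU by (intro card_Diff1_less) auto
  moreover have "?U = {k} \<or> ?U - {k} \<in> F"
    using ends_child[OF m less.prems(1)] by (auto simp: ends_def)
  ultimately have IH: "v \<in> component (edges (S \<inter> ?U)) u"
    if "u \<in> S \<inter> ?U - T" "v \<in> S \<inter> ?U - T" for u v
    using less.hyps[of ?U u v] that mU mT less.prems by blast
  let ?comp = "component (edges (S \<inter> U))"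
  have conn: "v \<in> ?comp u" if "u \<in> S \<inter> ?U - T" "v \<in> S \<inter> ?U - T" for u v
  proof -
    have "edges (S \<inter> ?U) \<subseteq> edges (S \<inter> U)" by (intro edges_mono) auto
    from component_mono[OF this] IH[OF that] show ?thesis by (rule subsetD)
  qed
  have link: "\<exists>j \<in> S \<inter> ?U - T. j \<in> ?comp m" if mS: "m \<in> S" and w: "w \<in> S \<inter> ?U - T" for w
  proof -
    have "insert w (insert m T) \<subseteq> S \<inter> U" using mS w mU less.prems S by auto
    moreover have "card (insert w (insert m T)) = card T + 2" using w mT finite_T by simp
    ultimately have c: "card T + 2 \<le> card (S \<inter> U)" using fU by (metis card_mono finite_Int)
    have "(U - {k}) \<inter> S = S \<inter> U - {k}" by blast
    then have "card T + 1 \<le> card ((U - {k}) \<inter> S)" 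
      using c diff_card_le_card_Diff[of "{k}" "S \<inter> U"] by simp
    moreover have "U - {k} = {m} \<or> U - {k} - {m} \<in> F"
      using ends_child[OF ends_commute[OF m] less.prems(1)] by (auto simp: ends_def)
    ultimately obtain Q where Q: "Q \<in> F" "m \<in> Q" "Q \<subseteq> U - {k}" "card (Q \<inter> S) = card T + 1"
      using descend[of "U - {k}" m S "card T + 1"] mU mS by auto
    let ?P = "S \<inter> Q"
    have cP: "card ?P = card T + 1" using Q by (simp add: Int_commute)
    have P: "?P \<in> tight" using S Q mS cP card_W_eq by (intro small_trace) auto
    \<comment> \<open>Pigeonhole: \<open>?P\<close> has one element more than \<open>T\<close> and
      misses \<open>k\<close>, so \<open>m\<close> cannot be its only element outside
      \<open>T\<close>.\<close>
    have "\<exists>j\<in>?P - T. j \<noteq> m"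
    proof (rule ccontr)
      assume "\<not> ?thesis"
      then have "?P \<subseteq> insert m (T - {k})" using Q by blast
      then have "card ?P \<le> card (insert m (T - {k}))" using finite_T by (intro card_mono) auto
      also have "\<dots> = card T" using finite_T mT S(3) card_gt_0_iff[of T] by (auto simp: card_Diff_singleton)
      finally show False using cP by simp
    qed
    then obtain j where j: "j \<in> ?P - T" "j \<noteq> m" by blast
    have "?P - T \<in> edges (S \<inter> U)" unfolding edges_def using P Q j by blast
    then have "j \<in> ?comp m" using j mS mT Q by (intro component_edge[of "?P - T"]) auto
    with j Q show ?thesis by blast
  qed
  have to_m: "m \<in> ?comp w" if w: "m \<in> S" "w \<in> S \<inter> ?U - T" for w
  proof -
    obtain j where j: "j \<in> S \<inter> ?U - T" "j \<in> ?comp m" using link[OF w] by blast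
    have "m \<in> ?comp j" using component_sym[OF j(2)] .
    with component_eq[OF conn[OF w(2) j(1)]] show ?thesis by simp
  qed
  show ?case
  proof (cases "u = m"; cases "v = m")
    assume "u = m" "v = m" then show ?thesis by (simp add: component_refl)
  next
    assume "u = m" "v \<noteq> m" then show ?thesis using to_m[of v] less.prems component_sym by fast
  next
    assume "u \<noteq> m" "v = m" then show ?thesis using to_m[of u] less.prems by fast
  next
    assume "u \<noteq> m" "v \<noteq> m" then show ?thesis using conn[of u v] less.prems by fast
  qed
qed

lemma splits_nonneg:
  assumes "C \<in> below" shows "0 \<le> splits C"
proof (cases "T \<subset> C")
  case True
  then have "1 \<le> num_components (C - T) (edges C)"
    using finite_below_member[OF assms] by (intro num_components_pos) auto
  then show ?thesis by (simp add: splits_def)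
qed (simp add: splits_def)

text \<open>Positive excess provides a set \<open>S\<close> of \<open>b\<close> with trace
  \<open>C\<close> on the hull of \<open>C\<close>. Then \<open>C - {l}\<close> is the trace of
  \<open>S\<close> on the child of the hull that lacks \<open>l\<close>, and \<open>k\<close> is
  removable from that child, so \<open>trace_connected\<close> leaves at most one component.\<close>

lemma splits_Diff_end_le_0:
  assumes C: "C \<in> below" "0 < excess C" and kl: "ends (family_hull C) k l" and k: "k \<in> T"
    and TC: "T \<subseteq> C"
  shows "splits (C - {l}) \<le> 0"
proof (cases "T \<subset> C - {l}")
  case True
  obtain S where S: "S \<in># b" "S \<inter> family_hull C = C" using excess_pos_imp[OF C(2)] by blast
  let ?U = "family_hull C - {l}"
  have eq: "S \<inter> ?U = C - {l}" using S by blast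
  have "num_components (C - {l} - T) (edges (C - {l})) \<le> 1"
  proof (rule num_components_le_1)
    fix u v assume uv: "u \<in> C - {l} - T" "v \<in> C - {l} - T"
    have "v \<in> component (edges (S \<inter> ?U)) u"
    proof (rule trace_connected[OF S(1) _ k])
      show "?U \<in> F" using kl by (simp add: ends_def)
      show "T \<subseteq> S" "T \<subseteq> ?U" using True eq by blast+
      show "?U = {k} \<or> ?U - {k} \<in> F"
        using ends_child[OF kl family_hull_mem[OF C(1)]] by (auto simp: ends_def)
    qed (use uv eq in auto)
    then show "v \<in> component (edges (C - {l})) u" unfolding eq .
  qed
  then show ?thesis by (simp add: splits_def)
qed (simp add: splits_def)

text \<open>A tight set inside \<open>C\<close> containing both ends would contain the hull of
  \<open>C\<close>, hence equal \<open>C\<close>, whose excess is positive.\<close>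

lemma edges_ends:
  assumes C: "C \<in> below" "0 < excess C" and kl: "ends (family_hull C) k l"
  shows "edges C = edges (C - {k}) \<union> edges (C - {l})"
proof (intro subset_antisym Un_least edges_mono)
  show "edges C \<subseteq> edges (C - {k}) \<union> edges (C - {l})"
  proof
    fix X assume "X \<in> edges C"
    then obtain P where P: "P \<in> tight" "P \<subseteq> C" "\<not> P \<subseteq> T" "X = P - T"
      unfolding edges_def by blast
    have "\<not> (k \<in> P \<and> l \<in> P)"
    proof
      assume "k \<in> P \<and> l \<in> P"
      then have "family_hull C \<subseteq> P" using kl P by (auto simp: ends_def tight_def)
      then have "P = C" using P subset_family_hull[of C] by blast
      with P C show False by (simp add: tight_def)
    qed
    then have "P \<subseteq> C - {k} \<or> P \<subseteq> C - {l}" using P by blast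
    with P show "X \<in> edges (C - {k}) \<union> edges (C - {l})" unfolding edges_def by blast
  qed
qed auto

text \<open>If \<open>T\<close> is not inside \<open>C\<close>, all four values are 0. If an end
  lies in \<open>T\<close>, the sets lacking it have value 0 and \<open>splits_Diff_end_le_0\<close>
  bounds the negative term that is left. Otherwise, by \<open>edges_ends\<close>, this is
  supermodularity of the number of components.\<close>

lemma mixed_diff_splits_nonneg:
  assumes C: "C \<in> below" "0 < excess C"
  shows "0 \<le> mixed_diff splits C"
proof -
  have c: "card T + 2 \<le> card C" using large_if_excess[OF C] .
  then have c1: "card C \<noteq> 1" by simp
  obtain k l where p: "end_pair C = (k, l)" by fastforce
  have kl: "ends (family_hull C) k l" using ends_end_pair[OF C(1) c1 p] .
  have kC: "k \<in> C" "l \<in> C" using ends_family_hull_mem[OF C(1) kl] by auto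
  have ne: "k \<noteq> l" using kl by (simp add: ends_def)
  have fC: "finite C" using finite_below_member[OF C(1)] .
  have md: "mixed_diff splits C =
      splits C - splits (C - {k}) - splits (C - {l}) + splits (C - {k, l})"
    using c1 p by (simp add: mixed_diff_def)
  have nn: "0 \<le> splits C" using splits_nonneg[OF C(1)] .
  have out: "splits (C - X) = 0" if "X \<inter> T \<noteq> {} \<or> \<not> T \<subseteq> C" for X
    using that by (auto simp: splits_def)
  consider "\<not> T \<subseteq> C" | "T \<subseteq> C" "k \<in> T" | "T \<subseteq> C" "l \<in> T" | "T \<subseteq> C" "k \<notin> T" "l \<notin> T"
    by blast
  then show ?thesis
  proof cases
    case 1
    then show ?thesis using nn out[of "{k}"] out[of "{l}"] out[of "{k, l}"] md by simp
  next
    case 2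
    then have "splits (C - {l}) \<le> 0" using splits_Diff_end_le_0[OF C kl] by simp
    with 2 show ?thesis using nn out[of "{k}"] out[of "{k, l}"] md by simp
  next
    case 3
    then have "splits (C - {k}) \<le> 0" using splits_Diff_end_le_0[OF C ends_commute[OF kl]] by simp
    with 3 show ?thesis using nn out[of "{l}"] out[of "{k, l}"] md by simp
  next
    case 4
    let ?D = "C - T"
    let ?N = "\<lambda>X. int (num_components (C - X - T) (edges (C - X)))"
    \<comment> \<open>The deleted ends are isolated vertices of \<open>?D\<close>, so counting on
      this common vertex set adds \<open>card X\<close>; these corrections cancel in the mixed
      difference.\<close>
    have N: "int (num_components ?D (edges (C - X))) = ?N X + int (card X)" if "X \<subseteq> {k, l}" for X
    proof -
      have "\<Union>(edges (C - X)) \<subseteq> C - X - T" using edges_subset by blast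
      then have "int (num_components ?D (edges (C - X))) = ?N X + int (card (?D - (C - X - T)))"
        using num_components_extend[of ?D "C - X - T" "edges (C - X)"] fC
        by (metis Diff_mono Diff_subset finite_Diff of_nat_add order_refl)
      moreover have "?D - (C - X - T) = X" using that 4 kC by auto
      ultimately show ?thesis by simp
    qed
    have sub: "edges (C - {k, l}) \<subseteq> edges (C - {k})" "edges (C - {k, l}) \<subseteq> edges (C - {l})"
      by (auto intro!: edges_mono)
    have "num_components ?D (edges (C - {k, l}) \<union> edges (C - {l}))
          + num_components ?D (edges (C - {k}))
        \<le> num_components ?D (edges (C - {k}) \<union> edges (C - {l}))
          + num_components ?D (edges (C - {k, l}))"
      using fC sub finite_edges edges_subset
      by (intro num_components_supermodular) (auto dest!: edges_subset)
    then have "num_components ?D (edges (C - {l})) + num_components ?D (edges (C - {k}))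
        \<le> num_components ?D (edges C) + num_components ?D (edges (C - {k, l}))"
      using sub(2) edges_ends[OF C kl] by (simp add: Un_absorb1)
    then have "?N {l} + ?N {k} \<le> ?N {} + ?N {k, l}"
      using N[of "{k}"] N[of "{l}"] N[of "{k, l}"] N[of "{}"] ne by simp
    moreover have "T \<subset> C" "T \<subset> C - {k}" "T \<subset> C - {l}" using 4 kC ne by auto
    then have "splits C = ?N {} - 1" "splits (C - {k}) = ?N {k} - 1" "splits (C - {l}) = ?N {l} - 1"
      by (simp_all add: splits_def)
    \<comment> \<open>Only an inequality: for \<open>T = C - {k, l}\<close> the left side is 0 and
      the right side is -1. It goes in the favourable direction, as this term enters with a plus
      sign.\<close>
    moreover have "splits (C - {k, l}) \<ge> ?N {k, l} - 1"
    proof (cases "T = C - {k, l}")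
      case True
      then show ?thesis by (simp add: splits_def num_components_def)
    next
      case False
      then have "T \<subset> C - {k, l}" using 4 by auto
      then show ?thesis by (simp add: splits_def)
    qed
    ultimately show ?thesis using md by simp
  qed
qed

text \<open>By \<open>edges_ends\<close> no hyperedge joins \<open>x\<close> to \<open>y\<close>, so
  \<open>W - T\<close> has two components; the other three sets have value 0.\<close>

lemma mixed_diff_splits_W: "mixed_diff splits W = 1"
proof -
  have WT: "W - T = {x, y}" "W - {x} - T = {y}" "W - {y} - T = {x}" "W - {x, y} = T"
    using xy by (auto simp: T_def)
  have sub: "T \<subset> W" "T \<subset> W - {x}" "T \<subset> W - {y}" using xy by (auto simp: T_def)
  have "num_components {x, y} (edges W) = card {x, y}"
  proof (rule num_components_discrete)
    fix X assume "X \<in> edges W"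
    then have "X \<in> edges (W - {x}) \<or> X \<in> edges (W - {y})"
      using edges_ends[OF W_below W_excess ends_W] by blast
    then have "X \<subseteq> {x} \<or> X \<subseteq> {y}"
      using edges_subset[of X "W - {x}"] edges_subset[of X "W - {y}"] WT by metis
    then show "\<exists>x. X \<subseteq> {x}" by blast
  qed
  then have "splits W = 1" using sub WT xy by (simp add: splits_def)
  moreover have "splits (W - {x}) = 0" "splits (W - {y}) = 0" "splits T = 0"
    using sub WT by (simp_all add: splits_def num_components_def)
  ultimately show ?thesis using card_W end_pair_W WT by (simp add: mixed_diff_def)
qed

lemma ex_splits_pos: "\<exists>S\<in>#b. 0 < splits S"
proof (rule ccontr)
  assume "\<not> ?thesis"
  then have "(\<Sum>S\<in>#b. splits S) \<le> (\<Sum>S\<in>#b. 0)" by (intro sum_mset_mono) auto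
  moreover have "(\<Sum>S\<in>#a. 0) \<le> (\<Sum>S\<in>#a. splits S)"
    using a_sub mem_below splits_nonneg by (intro sum_mset_mono) auto
  moreover have "0 < (\<Sum>C\<in>below. mixed_diff splits C * excess C)"
  proof (rule sum_pos2[of _ W])
    show "0 < mixed_diff splits W * excess W" using mixed_diff_splits_W W_excess by simp
    fix C assume C: "C \<in> below"
    show "0 \<le> mixed_diff splits C * excess C"
    proof (cases "excess C = 0")
      case False
      then have "0 < excess C" using excess_nonneg[OF C] by simp
      with mixed_diff_splits_nonneg[OF C this] show ?thesis by simp
    qed simp
  qed (use finite_below W_below in auto)
  moreover have "splits {} = 0" by (auto simp: splits_def)
  ultimately show False using sum_diff_eq[of splits] by simp
qed

text \<open>Let \<open>K\<close> be one of several components of \<open>S - T\<close>, and take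
  \<open>U = T \<union> K\<close> and \<open>V = S - K\<close>, which meet in \<open>T\<close>. A
  member inside \<open>S\<close> but in neither of them has points in \<open>K\<close> and points
  outside \<open>T \<union> K\<close>; were it tight, it would be a hyperedge leaving the component
  \<open>K\<close>.\<close>

lemma ex_transfer:
  "\<exists>S U V. S \<in># b \<and> (U \<inter> V = {} \<or> U \<inter> V \<in># b) \<and> S = U \<union> V \<and> \<not> U \<subseteq> V \<and> \<not> V \<subseteq> U \<and>
    (\<forall>P\<in>F. P \<subseteq> S \<longrightarrow> P \<subseteq> U \<or> P \<subseteq> V \<or> 0 < excess P)"
proof -
  obtain S where S: "S \<in># b" "0 < splits S" using ex_splits_pos by blast
  then have TS: "T \<subset> S" and nc: "\<not> num_components (S - T) (edges S) \<le> 1"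
    by (auto simp: splits_def split: if_splits)
  from nc num_components_le_1[of "S - T" "edges S"] obtain v w
    where vw: "v \<in> S - T" "w \<in> S - T" "w \<notin> component (edges S) v" by auto
  define K where "K = component (edges S) v"
  have K: "K \<subseteq> S - T" unfolding K_def using vw edges_subset by (intro component_least) blast+
  have "v \<in> K" unfolding K_def by (rule component_refl)
  let ?U = "T \<union> K" and ?V = "S - K"
  have "P \<subseteq> ?U \<or> P \<subseteq> ?V \<or> 0 < excess P" if P: "P \<in> F" "P \<subseteq> S" for P
  proof (rule ccontr)
    assume "\<not> ?thesis"
    then have *: "\<not> P \<subseteq> ?U" "\<not> P \<subseteq> ?V" "excess P = 0"
      using excess_nonneg[OF mem_below[OF P(1)]] by auto
    then obtain i j where ij: "i \<in> P" "i \<notin> T \<union> K" "j \<in> P" "j \<in> K" using P by blast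
    have "P - T \<in> edges S" using P * unfolding edges_def tight_def by blast
    then have "i \<in> component (edges S) j" using ij K by (intro component_edge[of "P - T"]) auto
    moreover have "component (edges S) j = component (edges S) v"
      using ij component_eq unfolding K_def by fast
    ultimately show False using ij unfolding K_def by blast
  qed
  moreover have "?U \<inter> ?V = T" "S = ?U \<union> ?V" using K TS by blast+
  moreover have "\<not> ?U \<subseteq> ?V" "\<not> ?V \<subseteq> ?U" using \<open>v \<in> K\<close> K vw unfolding K_def by blast+
  moreover have "T = {} \<or> T \<in># b" using T_in_b by blast
  ultimately show ?thesis using S(1) by metis
qed

end

context dominated_family begin

lemma ex_transfer:
  assumes "a \<noteq> b"
  shows "\<exists>S U V. S \<in># b \<and> (U \<inter> V = {} \<or> U \<inter> V \<in># b) \<and> S = U \<union> V \<and> \<not> U \<subseteq> V \<and> \<not> V \<subseteq> U \<and>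
    (\<forall>P\<in>F. P \<subseteq> S \<longrightarrow> P \<subseteq> U \<or> P \<subseteq> V \<or> 0 < excess P)"
proof -
  obtain C where C: "C \<in> below" "0 < excess C"
    using eq_if_excess_eq_0 excess_nonneg assms by (metis order_le_less)
  obtain W where W: "W \<in> below" "0 < excess W"
    and min: "\<And>D. \<lbrakk>D \<in> below; 0 < excess D\<rbrakk> \<Longrightarrow> card W \<le> card D"
    using ex_has_least_nat[of "\<lambda>C. C \<in> below \<and> 0 < excess C" C card] C by blast
  obtain x y where "end_pair W = (x, y)" by fastforce
  interpret minimal_excess F a b W x y
  proof
    fix D assume D: "D \<in> below" "card D < card W"
    then have "\<not> 0 < excess D" using min[of D] by auto
    with excess_nonneg[OF D(1)] show "excess D = 0" by simp
  qed fact+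
  show ?thesis by (rule ex_transfer)
qed

end

section \<open>Supermodular functions of Bernoulli sums\<close>

text \<open>Defined on all functions, so that indicators can be added without regard to a domain;
  \<open>supermodular_restrict\<close> links it to \<open>supermodular\<close>.\<close>

definition supermodular_fun :: "(('a \<Rightarrow> real) \<Rightarrow> real) \<Rightarrow> bool" where
  "supermodular_fun f \<longleftrightarrow> (\<forall>x y. f x + f y \<le> f (inf x y) + f (sup x y))"

definition add_indicator :: "'a set \<Rightarrow> ('a \<Rightarrow> real) \<Rightarrow> 'a \<Rightarrow> real" where
  "add_indicator S x = (\<lambda>i. x i + of_bool (i \<in> S))"

definition bern_step :: "real \<Rightarrow> 'a set \<Rightarrow> (('a \<Rightarrow> real) \<Rightarrow> real) \<Rightarrow> ('a \<Rightarrow> real) \<Rightarrow> real" where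
  "bern_step p S f x = (1 - p) * f x + p * f (add_indicator S x)"

text \<open>\<open>bern_mean p f b x\<close> is the mean of \<open>f\<close> at \<open>x\<close> plus the sum of the indicators of the members
  of \<open>b\<close>, each multiplied by its own independent Bernoulli variable of parameter \<open>p\<close>.\<close>

definition bern_mean ::
  "real \<Rightarrow> (('a \<Rightarrow> real) \<Rightarrow> real) \<Rightarrow> 'a set multiset \<Rightarrow> ('a \<Rightarrow> real) \<Rightarrow> real" where
  "bern_mean p f b = fold_mset (bern_step p) f b"

lemma add_indicator_commute: "add_indicator S (add_indicator T x) = add_indicator T (add_indicator S x)"
  by (auto simp: add_indicator_def)

lemma comp_fun_commute_bern_step: "comp_fun_commute (bern_step p)"
proof
  fix S T :: "'a set"
  show "bern_step p T \<circ> bern_step p S = bern_step p S \<circ> bern_step p T"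
    by (intro ext) (simp add: bern_step_def add_indicator_commute[of S T] algebra_simps)
qed

lemma bern_mean_empty [simp]: "bern_mean p f {#} = f"
  by (simp add: bern_mean_def)

lemma bern_mean_add [simp]: "bern_mean p f (add_mset S b) = bern_step p S (bern_mean p f b)"
proof -
  interpret comp_fun_commute "bern_step p :: 'a set \<Rightarrow> _" by (rule comp_fun_commute_bern_step)
  show ?thesis by (simp add: bern_mean_def)
qed

lemma bern_step_empty: "bern_step p {} f = f"
  by (intro ext) (simp add: bern_step_def add_indicator_def algebra_simps)

text \<open>Adding an indicator is a translation, which commutes with \<open>inf\<close> and
  \<open>sup\<close>; a convex combination preserves the inequality.\<close>

lemma supermodular_bern_step:
  assumes "supermodular_fun f" "0 \<le> p" "p \<le> 1"
  shows "supermodular_fun (bern_step p S f)"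
  unfolding supermodular_fun_def
proof (intro allI)
  fix x y
  have 1: "(1 - p) * (f x + f y) \<le> (1 - p) * (f (inf x y) + f (sup x y))"
    using assms by (intro mult_left_mono) (auto simp: supermodular_fun_def)
  have "inf (add_indicator S x) (add_indicator S y) = add_indicator S (inf x y)"
    "sup (add_indicator S x) (add_indicator S y) = add_indicator S (sup x y)"
    by (auto simp: add_indicator_def fun_eq_iff inf_real_def sup_real_def)
  then have "f (add_indicator S x) + f (add_indicator S y) \<le> f (add_indicator S (inf x y)) + f (add_indicator S (sup x y))"
    using assms(1) unfolding supermodular_fun_def by metis
  then have 2: "p * (f (add_indicator S x) + f (add_indicator S y))
      \<le> p * (f (add_indicator S (inf x y)) + f (add_indicator S (sup x y)))"
    using assms(2) by (intro mult_left_mono)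
  from 1 2 show "bern_step p S f x + bern_step p S f y
      \<le> bern_step p S f (inf x y) + bern_step p S f (sup x y)"
    unfolding bern_step_def by (simp add: algebra_simps)
qed

lemma supermodular_bern_mean:
  assumes "supermodular_fun f" "0 \<le> p" "p \<le> 1"
  shows "supermodular_fun (bern_mean p f b)"
  using assms by (induction b) (auto intro: supermodular_bern_step)

text \<open>The two sides agree on the outcomes with no success and with two successes, since the
  indicators of \<open>U\<close> and \<open>V\<close> have the same sum as those of
  \<open>U \<union> V\<close> and \<open>U \<inter> V\<close>. The outcomes with one success have
  weight \<open>p * (1 - p)\<close>, and there supermodularity applies.\<close>

lemma bern_step_transfer:
  assumes "supermodular_fun f" "0 \<le> p" "p \<le> 1"
  shows "bern_step p U (bern_step p V f) x \<le> bern_step p (U \<union> V) (bern_step p (U \<inter> V) f) x"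
proof -
  have "inf (add_indicator U x) (add_indicator V x) = add_indicator (U \<inter> V) x" "sup (add_indicator U x) (add_indicator V x) = add_indicator (U \<union> V) x"
    by (auto simp: add_indicator_def fun_eq_iff inf_real_def sup_real_def)
  then have "f (add_indicator U x) + f (add_indicator V x) \<le> f (add_indicator (U \<inter> V) x) + f (add_indicator (U \<union> V) x)"
    using assms(1) unfolding supermodular_fun_def by metis
  then have "p * (1 - p) * (f (add_indicator U x) + f (add_indicator V x))
      \<le> p * (1 - p) * (f (add_indicator (U \<inter> V) x) + f (add_indicator (U \<union> V) x))"
    using assms by (intro mult_left_mono) auto
  moreover have "add_indicator (U \<inter> V) (add_indicator (U \<union> V) x) = add_indicator V (add_indicator U x)"
    by (auto simp: add_indicator_def fun_eq_iff)
  ultimately show ?thesis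
    unfolding bern_step_def by (simp add: algebra_simps)
qed

lemma bern_mean_0: "bern_mean 0 f b = f"
  by (induction b) (auto simp: bern_step_def)

lemma bern_mean_1: "bern_mean 1 f b x = f (\<lambda>i. x i + (\<Sum>S\<in>#b. of_bool (i \<in> S)))"
proof (induction b arbitrary: x)
  case (add S b)
  have "(\<lambda>i. add_indicator S x i + (\<Sum>T\<in>#b. of_bool (i \<in> T)))
      = (\<lambda>i. x i + (\<Sum>T\<in>#add_mset S b. of_bool (i \<in> T)))"
    by (auto simp: add_indicator_def)
  then show ?case using add[of "add_indicator S x"] by (simp add: bern_step_def)
qed simp

text \<open>The difference of the two sides is \<open>2 * g * h\<close>, with \<open>g\<close> and
  \<open>h\<close> the cardinalities of the two set differences.\<close>

lemma sum_squares_transfer: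
  assumes "finite U" "finite V" "\<not> U \<subseteq> V" "\<not> V \<subseteq> U"
  shows "(card U)\<^sup>2 + (card V)\<^sup>2 < (card (U \<union> V))\<^sup>2 + (card (U \<inter> V))\<^sup>2"
proof -
  define g h t where "g = card (U - V)" and "h = card (V - U)" and "t = card (U \<inter> V)"
  have "card U = g + t" "card V = h + t" "card (U \<union> V) = g + h + t"
  proof -
    have "U = (U - V) \<union> (U \<inter> V)" "V = (V - U) \<union> (U \<inter> V)" by auto
    then show "card U = g + t" "card V = h + t"
      using assms card_Un_disjoint[of "U - V" "U \<inter> V"] card_Un_disjoint[of "V - U" "U \<inter> V"]
      unfolding g_def h_def t_def by (metis Diff_disjoint Diff_Int_distrib2 Int_Diff Int_commute finite_Diff finite_Int)+
    then show "card (U \<union> V) = g + h + t"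
      using card_Un_Int[OF assms(1,2)] unfolding t_def by simp
  qed
  moreover have "0 < g" "0 < h" using assms by (auto simp: g_def h_def card_gt_0_iff)
  ultimately show ?thesis unfolding t_def[symmetric]
    by (simp add: power2_eq_square algebra_simps)
qed

section \<open>Iteration of the transfers\<close>

context binary_tree_family begin

lemma bern_mean_le:
  assumes f: "supermodular_fun f" and p: "0 \<le> p" "p \<le> 1"
    and dom: "dominated_family F a b"
  shows "bern_mean p f a x \<le> bern_mean p f b x"
  using dom
proof (induction "\<Sum>S\<in>#b. (card S)\<^sup>2" arbitrary: b rule: less_induct)
  case less
  interpret dominated_family F a b by (rule less.prems)
  show ?case
  proof (cases "a = b")
    case False
    from ex_transfer[OF this] obtain S U V where
      S: "S \<in># b" "S = U \<union> V" and T: "U \<inter> V = {} \<or> U \<inter> V \<in># b"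
      and UV: "\<not> U \<subseteq> V" "\<not> V \<subseteq> U"
      and P: "\<And>P. \<lbrakk>P \<in> F; P \<subseteq> S\<rbrakk> \<Longrightarrow> P \<subseteq> U \<or> P \<subseteq> V \<or> 0 < excess P"
      by metis
    have Sb: "S \<in> below" using S b_sub by blast
    have UVb: "U \<in> below" "V \<in> below" using below_subset[OF Sb] UV S by blast+
    have fin: "finite U" "finite V" using UVb finite_below_member by auto
    \<comment> \<open>An empty intersection is not an element of \<open>b\<close>, as
      \<open>below\<close> excludes the empty set; in the means it is harmless by
      \<open>bern_step_empty\<close>.\<close>
    define c where "c = (if U \<inter> V = {} then b - {#S#} else b - {#S#} - {#U \<inter> V#})"
    have b: "b = add_mset S (if U \<inter> V = {} then c else add_mset (U \<inter> V) c)"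
    proof (cases "U \<inter> V = {}")
      case True
      then show ?thesis using S by (simp add: c_def)
    next
      case False
      have "U \<inter> V \<noteq> S" using UV S by blast
      with False T have "U \<inter> V \<in># b - {#S#}" by (simp add: in_diff_count not_in_iff)
      then have "add_mset (U \<inter> V) c = b - {#S#}" 
        using False unfolding c_def by (simp only: if_False insert_DiffM)
      then show ?thesis using False S(1) by simp
    qed
    let ?b = "add_mset U (add_mset V c)"
    have c_sub: "set_mset c \<subseteq> below" using b_sub b by (auto split: if_splits)
    have count_b: "trace_count b P = trace_count c P + of_bool (P \<subseteq> S) + of_bool (P \<subseteq> U \<inter> V)"
      if "P \<in> F" for P
    proof -
      have "P \<noteq> {}" using that empty_notin by auto
      then show ?thesis by (subst b) (auto simp: trace_count_def trace_of_mem[OF that])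
    qed
    have count_b': "trace_count ?b P = trace_count c P + of_bool (P \<subseteq> U) + of_bool (P \<subseteq> V)"
      if "P \<in> F" for P
      using that by (simp add: trace_count_def trace_of_mem)
    have "dominated_family F a ?b"
    proof
      show "set_mset a \<subseteq> F" by (rule a_sub)
      show "set_mset ?b \<subseteq> below" using c_sub UVb by auto
      \<comment> \<open>The count drops only for \<open>Q\<close> inside \<open>S\<close> but in
        neither \<open>U\<close> nor \<open>V\<close>, and then by 1, which the positive excess
        allows. For singletons this case cannot occur.\<close>
      show "trace_count a Q \<le> trace_count ?b Q" if Q: "Q \<in> F" for Q
      proof -
        have "Q \<subseteq> U \<Longrightarrow> Q \<subseteq> S" "Q \<subseteq> V \<Longrightarrow> Q \<subseteq> S" using S(2) by auto
        then show ?thesis using trace_count_le[OF Q] P[OF Q]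
          unfolding count_b'[OF Q] excess_def count_b[OF Q] le_inf_iff
          by (cases "Q \<subseteq> S"; cases "Q \<subseteq> U"; cases "Q \<subseteq> V") simp_all
      qed
      show "trace_count a {i} = trace_count ?b {i}" if Q: "{i} \<in> F" for i
        using trace_count_singleton[OF Q] S(2)
        unfolding count_b'[OF Q] count_b[OF Q] by (auto simp: of_bool_def)
    qed
    moreover have "(\<Sum>S\<in>#?b. (card S)\<^sup>2) < (\<Sum>S\<in>#b. (card S)\<^sup>2)"
    proof -
      have "(\<Sum>S\<in>#b. (card S)\<^sup>2) = (\<Sum>S\<in>#c. (card S)\<^sup>2) + (card S)\<^sup>2 + (card (U \<inter> V))\<^sup>2"
        by (subst b) auto
      then show ?thesis using sum_squares_transfer[OF fin UV] S(2) by simp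
    qed
    ultimately have "bern_mean p f a x \<le> bern_mean p f ?b x" using less.hyps by blast
    also have "\<dots> \<le> bern_step p S (bern_step p (U \<inter> V) (bern_mean p f c)) x"
      using bern_step_transfer[OF supermodular_bern_mean[OF f p] p] S(2) by simp
    also have "\<dots> = bern_mean p f b x"
      by (subst b) (auto simp: bern_step_empty)
    finally show ?thesis .
  qed simp
qed

end

section \<open>Moments and expectations\<close>

text \<open>\<open>K\<close> is the set of successful trials; the subsets of
  \<open>insert r R\<close> are split by whether they contain \<open>r\<close>.\<close>

lemma bern_mean_image_mset:
  assumes "finite R"
  shows "bern_mean p f (image_mset L (mset_set R)) x =
    (\<Sum>K\<in>Pow R. (\<Prod>r\<in>R. if r \<in> K then p else 1 - p) * f (\<lambda>i. x i + (\<Sum>r\<in>K. of_bool (i \<in> L r))))"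
  using assms
proof (induction R arbitrary: x)
  case (insert r R)
  let ?w = "\<lambda>R K. \<Prod>r\<in>R. if r \<in> K then p else 1 - p"
  let ?f = "\<lambda>x K. f (\<lambda>i. x i + (\<Sum>r\<in>K. of_bool (i \<in> L r)))"
  have inj: "inj_on (insert r) (Pow R)" using insert.hyps by (auto simp: inj_on_def)
  have disj: "Pow R \<inter> insert r ` Pow R = {}" using insert.hyps by auto
  have fin: "finite K" if "K \<in> Pow R" for K using that insert.hyps finite_subset by auto
  have "(\<Sum>K\<in>Pow (insert r R). ?w (insert r R) K * ?f x K)
      = (\<Sum>K\<in>Pow R. ?w (insert r R) K * ?f x K)
        + (\<Sum>K\<in>Pow R. ?w (insert r R) (insert r K) * ?f x (insert r K))"
    using insert.hyps disj inj
    by (simp add: Pow_insert sum.union_disjoint sum.reindex)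
  also have "(\<Sum>K\<in>Pow R. ?w (insert r R) K * ?f x K) = (1 - p) * (\<Sum>K\<in>Pow R. ?w R K * ?f x K)"
    using insert.hyps by (auto simp: sum_distrib_left mult.assoc intro!: sum.cong)
  also have "(\<Sum>K\<in>Pow R. ?w (insert r R) (insert r K) * ?f x (insert r K))
      = p * (\<Sum>K\<in>Pow R. ?w R K * ?f (add_indicator (L r) x) K)"
    unfolding sum_distrib_left
  proof (intro sum.cong refl)
    fix K assume K: "K \<in> Pow R"
    then have rK: "r \<notin> K" using insert.hyps by auto
    have "?w (insert r R) (insert r K) = p * ?w R K"
      using insert.hyps by (auto intro!: prod.cong)
    moreover have "?f x (insert r K) = ?f (add_indicator (L r) x) K"
      unfolding add_indicator_def add.assoc sum.insert[OF fin[OF K] rK] ..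
    ultimately show "?w (insert r R) (insert r K) * ?f x (insert r K)
        = p * (?w R K * ?f (add_indicator (L r) x) K)" by simp
  qed
  finally show ?case using insert by (simp add: bern_step_def)
qed simp

lemma bernoulli_rv_measure:
  assumes "bernoulli_rv M p X" "B \<in> sets borel"
  shows "measure M (X -` B \<inter> space M) = measure (bernoulli_pmf p) {t. of_bool t \<in> B}"
proof -
  have X: "X \<in> borel_measurable M"
    and eq: "distr M borel X = distr (measure_pmf (bernoulli_pmf p)) borel of_bool"
    using assms(1) by (auto simp: bernoulli_rv_def)
  have "measure M (X -` B \<inter> space M) = measure (distr M borel X) B"
    using X assms(2) by (simp add: measure_distr)
  also have "\<dots> = measure (bernoulli_pmf p) (of_bool -` B)"
    unfolding eq using assms(2) by (subst measure_distr) auto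
  finally show ?thesis by (simp add: vimage_def)
qed

context prob_space begin

lemma bernoulli_rv_prob_1:
  assumes "bernoulli_rv M p X" "0 \<le> p" "p \<le> 1"
  shows "prob (X -` {1} \<inter> space M) = p"
proof -
  have "{t. of_bool t \<in> {1::real}} = {True}" by auto
  then show ?thesis using bernoulli_rv_measure[OF assms(1), of "{1}"] assms
    by (simp add: measure_pmf_single)
qed

lemma bernoulli_rv_AE:
  assumes "bernoulli_rv M p X"
  shows "AE \<omega> in M. X \<omega> = 0 \<or> X \<omega> = 1"
proof -
  have "{t. of_bool t \<in> {0, 1::real}} = UNIV" by auto
  then have 1: "prob (X -` {0, 1} \<inter> space M) = 1"
    using bernoulli_rv_measure[OF assms, of "{0, 1}"] by simp
  have "X -` {0, 1} \<inter> space M \<in> events"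
    using assms by (intro measurable_sets[of _ _ borel]) (auto simp: bernoulli_rv_def)
  from AE_in_set_eq_1[OF this] 1 show ?thesis by (auto elim!: AE_mp)
qed

text \<open>The events that exactly the trials in \<open>K\<close> succeed split the space into
  finitely many pieces, so \<open>G\<close> can be arbitrary.\<close>

lemma expectation_of_successes:
  fixes G :: "'i set \<Rightarrow> real"
  assumes "finite R" "R \<noteq> {}" and ind: "indep_vars (\<lambda>_. borel) Z R"
    and bern: "\<And>r. r \<in> R \<Longrightarrow> bernoulli_rv M p (Z r)" and p: "0 \<le> p" "p \<le> 1"
  shows "(\<lambda>\<omega>. G {r\<in>R. Z r \<omega> = 1}) \<in> borel_measurable M"
    and "expectation (\<lambda>\<omega>. G {r\<in>R. Z r \<omega> = 1}) =
      (\<Sum>K\<in>Pow R. (\<Prod>r\<in>R. if r \<in> K then p else 1 - p) * G K)"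
proof -
  \<comment> \<open>Failure is encoded as being different from 1 instead of being 0, so that the
    events \<open>E K\<close> cover the space without an exceptional null set.\<close>
  define B :: "'i set \<Rightarrow> 'i \<Rightarrow> real set" where "B K r = (if r \<in> K then {1} else - {1})" for K r
  define E where "E K = (\<Inter>r\<in>R. Z r -` B K r \<inter> space M)" for K
  have [measurable]: "Z r \<in> borel_measurable M" if "r \<in> R" for r
    using bern[OF that] by (simp add: bernoulli_rv_def)
  have B: "B K r \<in> sets borel" for K r by (simp add: B_def)
  have E_ev: "E K \<in> events" for K
    unfolding E_def using assms(1,2) B by (intro sets.finite_INT measurable_sets[of _ _ borel]) auto
  have "prob (Z r -` B K r \<inter> space M) = (if r \<in> K then p else 1 - p)" if r: "r \<in> R" for K r
  proof (cases "r \<in> K")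
    case True
    then show ?thesis using bernoulli_rv_prob_1[OF bern[OF r] p] by (simp add: B_def)
  next
    case False
    have "Z r -` B K r \<inter> space M = space M - (Z r -` {1} \<inter> space M)"
      using False by (auto simp: B_def)
    moreover have "Z r -` {1} \<inter> space M \<in> events" using r by (intro measurable_sets[of _ _ borel]) auto
    ultimately show ?thesis
      using False bernoulli_rv_prob_1[OF bern[OF r] p] by (simp add: prob_compl)
  qed
  then have prob_E: "prob (E K) = (\<Prod>r\<in>R. if r \<in> K then p else 1 - p)" for K
    unfolding E_def using indep_varsD_finite[OF ind assms(2,1) B] by simp
  have G: "G {r\<in>R. Z r \<omega> = 1} = (\<Sum>K\<in>Pow R. indicator (E K) \<omega> * G K)" if w: "\<omega> \<in> space M" for \<omega>
  proof -
    have "indicator (E K) \<omega> = (of_bool (K = {r\<in>R. Z r \<omega> = 1}) :: real)" if "K \<in> Pow R" for K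
      using that w by (auto simp: E_def B_def indicator_def split: if_splits)
    then have "(\<Sum>K\<in>Pow R. indicator (E K) \<omega> * G K)
        = (\<Sum>K\<in>Pow R. of_bool (K = {r\<in>R. Z r \<omega> = 1}) * G K)" by simp
    also have "\<dots> = G {r\<in>R. Z r \<omega> = 1}"
      using assms(1) by (subst sum.remove[of _ "{r\<in>R. Z r \<omega> = 1}"]) (auto intro!: sum.neutral)
    finally show ?thesis by simp
  qed
  show "(\<lambda>\<omega>. G {r\<in>R. Z r \<omega> = 1}) \<in> borel_measurable M"
    using E_ev by (subst measurable_cong[OF G]) auto
  have "expectation (\<lambda>\<omega>. G {r\<in>R. Z r \<omega> = 1}) = expectation (\<lambda>\<omega>. \<Sum>K\<in>Pow R. indicator (E K) \<omega> * G K)"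
    by (intro Bochner_Integration.integral_cong G refl)
  also have "\<dots> = (\<Sum>K\<in>Pow R. prob (E K) * G K)"
    using E_ev assms(1) by (subst Bochner_Integration.integral_sum) (auto simp: less_top[symmetric])
  finally show "expectation (\<lambda>\<omega>. G {r\<in>R. Z r \<omega> = 1}) =
      (\<Sum>K\<in>Pow R. (\<Prod>r\<in>R. if r \<in> K then p else 1 - p) * G K)"
    by (simp add: prob_E)
qed

text \<open>The \<open>Z r\<close> take values 0 and 1 only almost everywhere, and \<open>f\<close>
  need not be measurable; hence the measurability hypothesis, which the integrability in
  \<open>sm_le\<close> supplies later.\<close>

lemma expectation_eq_bern_mean:
  assumes "finite R" "R \<noteq> {}" and ind: "indep_vars (\<lambda>_. borel) Z R"
    and bern: "\<And>r. r \<in> R \<Longrightarrow> bernoulli_rv M p (Z r)" and p: "0 \<le> p" "p \<le> 1"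
    and meas: "(\<lambda>\<omega>. f (\<lambda>i. \<Sum>r\<in>R. Z r \<omega> * of_bool (i \<in> L r))) \<in> borel_measurable M"
  shows "expectation (\<lambda>\<omega>. f (\<lambda>i. \<Sum>r\<in>R. Z r \<omega> * of_bool (i \<in> L r)))
    = bern_mean p f (image_mset L (mset_set R)) (\<lambda>_. 0)"
proof -
  let ?G = "\<lambda>K. f (\<lambda>i. \<Sum>r\<in>K. of_bool (i \<in> L r))"
  have "AE \<omega> in M. \<forall>r\<in>R. Z r \<omega> = 0 \<or> Z r \<omega> = 1"
    using assms(1) bernoulli_rv_AE[OF bern] by (intro AE_finite_allI) auto
  then have "AE \<omega> in M. f (\<lambda>i. \<Sum>r\<in>R. Z r \<omega> * of_bool (i \<in> L r)) = ?G {r\<in>R. Z r \<omega> = 1}"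
  proof (rule AE_mp, intro AE_I2 impI)
    fix \<omega> assume Z: "\<forall>r\<in>R. Z r \<omega> = 0 \<or> Z r \<omega> = 1"
    have "(\<Sum>r\<in>R. Z r \<omega> * of_bool (i \<in> L r)) = (\<Sum>r\<in>{r\<in>R. Z r \<omega> = 1}. of_bool (i \<in> L r))" for i
      using assms(1) Z by (intro sum.mono_neutral_cong_right) auto
    then show "f (\<lambda>i. \<Sum>r\<in>R. Z r \<omega> * of_bool (i \<in> L r)) = ?G {r\<in>R. Z r \<omega> = 1}" by simp
  qed
  then have "expectation (\<lambda>\<omega>. f (\<lambda>i. \<Sum>r\<in>R. Z r \<omega> * of_bool (i \<in> L r)))
      = expectation (\<lambda>\<omega>. ?G {r\<in>R. Z r \<omega> = 1})"
    using expectation_of_successes(1)[OF assms(1-6), of ?G] meas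
    by (intro integral_cong_AE) auto
  also have "\<dots> = bern_mean p f (image_mset L (mset_set R)) (\<lambda>_. 0)"
    using expectation_of_successes(2)[OF assms(1-6), of ?G]
    unfolding bern_mean_image_mset[OF assms(1)] by simp
  finally show ?thesis .
qed

end

section \<open>Families satisfying (H)\<close>

lemma finite_tri_idx: "finite (tri_idx d)"
proof (rule finite_subset)
  show "tri_idx d \<subseteq> {1..d} \<times> {1..d}" by (auto simp: tri_idx_def)
qed simp

lemma tree_family_cases:
  assumes "binary_tree_assumption d e" "P \<in> tree_family d e"
  obtains (leaf) k where "k \<in> {1..d}" "P = {k}"
    | (node) k l where "1 \<le> k" "k < l" "l \<le> d" "P = e k l" "k \<in> P" "l \<in> P"
        "P - {k} \<in> tree_family d e" "P - {l} \<in> tree_family d e"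
proof -
  obtain k l where kl: "1 \<le> k" "k \<le> l" "l \<le> d" "P = e k l"
    using assms(2) by (auto simp: tree_family_def tri_idx_def)
  show thesis
  proof (cases "k = l")
    case True
    then show ?thesis using kl assms(1) leaf[of k] by (auto simp: binary_tree_assumption_def)
  next
    case False
    then show ?thesis using kl assms(1) node[of k l] by (auto simp: binary_tree_assumption_def)
  qed
qed

text \<open>If the two indices of \<open>Q\<close> are \<open>k\<close> and \<open>l\<close>, then
  \<open>Q = e k l\<close>. Otherwise one of them is neither \<open>k\<close> nor \<open>l\<close>,
  and deleting it gives a smaller member that still contains both.\<close>

lemma tree_family_least:
  assumes H: "binary_tree_assumption d e" and kl: "1 \<le> k" "k < l" "l \<le> d"
  shows "\<lbrakk>Q \<in> tree_family d e; k \<in> Q; l \<in> Q\<rbrakk> \<Longrightarrow> e k l \<subseteq> Q"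
proof (induction "card Q" arbitrary: Q rule: less_induct)
  case less
  have fQ: "finite Q"
    using H less.prems by (auto simp: binary_tree_assumption_def intro: finite_subset)
  from H less.prems(1) show ?case
  proof (cases rule: tree_family_cases)
    case (leaf i)
    then show ?thesis using less.prems kl by auto
  next
    case (node k' l')
    show ?thesis
    proof (cases "{k', l'} = {k, l}")
      case True
      then have "k' = k" "l' = l" using kl node by (auto simp: doubleton_eq_iff)
      then show ?thesis using node by simp
    next
      case False
      then have "k' \<notin> {k, l} \<or> l' \<notin> {k, l}" using kl(2) node(2) by auto
      then obtain m where m: "m \<in> {k', l'}" "m \<notin> {k, l}" by blast
      have "card (Q - {m}) < card Q" using m node(5,6) fQ by (intro card_Diff1_less) auto
      moreover have "Q - {m} \<in> tree_family d e" using m(1) node(7,8) by auto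
      ultimately have "e k l \<subseteq> Q - {m}" using m(2) less.prems(2,3) by (intro less.hyps) auto
      then show ?thesis by blast
    qed
  qed
qed

lemma binary_tree_family_tree_family:
  assumes H: "binary_tree_assumption d e"
  shows "binary_tree_family (tree_family d e)"
proof
  show "finite (tree_family d e)" using finite_tri_idx by (simp add: tree_family_def)
  show "finite P" if "P \<in> tree_family d e" for P
    using H that by (auto simp: binary_tree_assumption_def intro: finite_subset)
  show "{} \<notin> tree_family d e"
  proof
    assume "{} \<in> tree_family d e"
    from H this show False by (cases rule: tree_family_cases) auto
  qed
  show "{i} \<in> tree_family d e" if "P \<in> tree_family d e" "i \<in> P" for P i
  proof -
    have i: "i \<in> {1..d}" using H that unfolding binary_tree_assumption_def by blast
    then have "e i i = {i}" using H by (simp add: binary_tree_assumption_def)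
    moreover have "e i i \<in> tree_family d e"
      using i by (force simp: tree_family_def tri_idx_def)
    ultimately show ?thesis by simp
  qed
  show "\<exists>k l. k \<noteq> l \<and> k \<in> P \<and> l \<in> P \<and> P - {k} \<in> tree_family d e \<and> P - {l} \<in> tree_family d e \<and>
      (\<forall>Q\<in>tree_family d e. k \<in> Q \<longrightarrow> l \<in> Q \<longrightarrow> P \<subseteq> Q)"
    if P: "P \<in> tree_family d e" "card P \<noteq> 1" for P
    using H P(1)
  proof (cases rule: tree_family_cases)
    case (node k l)
    have "\<forall>Q\<in>tree_family d e. k \<in> Q \<longrightarrow> l \<in> Q \<longrightarrow> P \<subseteq> Q"
      using tree_family_least[OF H node(1-3)] node(4) by simp
    with node(2,5-8) show ?thesis by (intro exI[of _ k] exI[of _ l]) simp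
  qed (use P in simp)
qed

section \<open>Moments of sums of independent Bernoulli variables\<close>

context prob_space begin

lemma bernoulli_rv_moments:
  assumes X: "bernoulli_rv M p X" and p: "0 \<le> p" "p \<le> 1"
  shows "integrable M X" "expectation X = p"
    "integrable M (\<lambda>\<omega>. X \<omega> * X \<omega>)" "expectation (\<lambda>\<omega>. X \<omega> * X \<omega>) = p"
proof -
  have [measurable]: "X \<in> borel_measurable M" using X by (simp add: bernoulli_rv_def)
  have AE: "AE \<omega> in M. X \<omega> = 0 \<or> X \<omega> = 1" using bernoulli_rv_AE[OF X] .
  show int: "integrable M X" "integrable M (\<lambda>\<omega>. X \<omega> * X \<omega>)"
    using AE by (auto intro!: integrable_const_bound[where B=1] elim!: AE_mp)
  have ev: "X -` {1} \<inter> space M \<in> events" by (intro measurable_sets[of _ _ borel]) auto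
  have "expectation X = expectation (indicator (X -` {1} \<inter> space M))"
    using AE ev by (intro integral_cong_AE) (auto elim!: AE_mp simp: indicator_def)
  then show E: "expectation X = p" using ev bernoulli_rv_prob_1[OF X p] by simp
  have "expectation (\<lambda>\<omega>. X \<omega> * X \<omega>) = expectation X"
    using AE by (intro integral_cong_AE) (auto elim!: AE_mp)
  with E show "expectation (\<lambda>\<omega>. X \<omega> * X \<omega>) = p" by simp
qed

lemma bernoulli_rv_mult:
  assumes ind: "indep_vars (\<lambda>_. borel) Z R" and r: "r \<in> R" "s \<in> R"
    and bern: "\<And>r. r \<in> R \<Longrightarrow> bernoulli_rv M p (Z r)" and p: "0 \<le> p" "p \<le> 1"
  shows "integrable M (\<lambda>\<omega>. Z r \<omega> * Z s \<omega>)"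
    "expectation (\<lambda>\<omega>. Z r \<omega> * Z s \<omega>) = p\<^sup>2 + p * (1 - p) * of_bool (r = s)"
proof -
  note mom = bernoulli_rv_moments[OF bern p]
  have "integrable M (\<lambda>\<omega>. Z r \<omega> * Z s \<omega>) \<and>
    expectation (\<lambda>\<omega>. Z r \<omega> * Z s \<omega>) = p\<^sup>2 + p * (1 - p) * of_bool (r = s)"
  proof (cases "r = s")
    case True
    then show ?thesis using mom(3,4)[OF r(2)] by (simp add: power2_eq_square algebra_simps)
  next
    case False
    have i: "indep_vars (\<lambda>_. borel) Z {r, s}" using indep_vars_subset[OF ind] r by auto
    have "integrable M (\<lambda>\<omega>. \<Prod>t\<in>{r, s}. Z t \<omega>)"
      using mom(1) r by (intro indep_vars_integrable[OF _ i]) auto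
    moreover have "expectation (\<lambda>\<omega>. \<Prod>t\<in>{r, s}. Z t \<omega>) = (\<Prod>t\<in>{r, s}. expectation (Z t))"
      using mom(1) r by (intro indep_vars_lebesgue_integral[OF _ i]) auto
    ultimately show ?thesis using False mom(2) r by (simp add: power2_eq_square)
  qed
  then show "integrable M (\<lambda>\<omega>. Z r \<omega> * Z s \<omega>)"
    "expectation (\<lambda>\<omega>. Z r \<omega> * Z s \<omega>) = p\<^sup>2 + p * (1 - p) * of_bool (r = s)" by auto
qed

lemma bernoulli_sum_moments:
  assumes ind: "indep_vars (\<lambda>_. borel) Z R" and R: "finite R" "I \<subseteq> R" "J \<subseteq> R"
    and bern: "\<And>r. r \<in> R \<Longrightarrow> bernoulli_rv M p (Z r)" and p: "0 \<le> p" "p \<le> 1"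
  shows "integrable M (\<lambda>\<omega>. \<Sum>r\<in>I. Z r \<omega>)"
    "expectation (\<lambda>\<omega>. \<Sum>r\<in>I. Z r \<omega>) = p * card I"
    "integrable M (\<lambda>\<omega>. (\<Sum>r\<in>I. Z r \<omega>) * (\<Sum>r\<in>J. Z r \<omega>))"
    "expectation (\<lambda>\<omega>. (\<Sum>r\<in>I. Z r \<omega>) * (\<Sum>r\<in>J. Z r \<omega>)) =
      p\<^sup>2 * card I * card J + p * (1 - p) * card (I \<inter> J)"
proof -
  note mom = bernoulli_rv_moments[OF bern p] and mult = bernoulli_rv_mult[OF ind _ _ bern p]
  show "integrable M (\<lambda>\<omega>. \<Sum>r\<in>I. Z r \<omega>)"
    using mom(1) R by (intro Bochner_Integration.integrable_sum) auto
  have "expectation (\<lambda>\<omega>. \<Sum>r\<in>I. Z r \<omega>) = (\<Sum>r\<in>I. expectation (Z r))"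
    using mom(1) R by (intro Bochner_Integration.integral_sum) auto
  also have "\<dots> = (\<Sum>r\<in>I. p)" using mom(2) R by (intro sum.cong) auto
  finally show "expectation (\<lambda>\<omega>. \<Sum>r\<in>I. Z r \<omega>) = p * card I" by simp
  show "integrable M (\<lambda>\<omega>. (\<Sum>r\<in>I. Z r \<omega>) * (\<Sum>r\<in>J. Z r \<omega>))"
    unfolding sum_product using mult(1) R by (intro Bochner_Integration.integrable_sum) auto
  have fin: "finite I" "finite J" using R finite_subset by auto
  have "expectation (\<lambda>\<omega>. (\<Sum>r\<in>I. Z r \<omega>) * (\<Sum>r\<in>J. Z r \<omega>))
      = (\<Sum>r\<in>I. \<Sum>s\<in>J. expectation (\<lambda>\<omega>. Z r \<omega> * Z s \<omega>))"
    unfolding sum_product using mult(1) R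
    by (subst Bochner_Integration.integral_sum)
      (auto intro!: sum.cong Bochner_Integration.integral_sum Bochner_Integration.integrable_sum)
  also have "\<dots> = (\<Sum>r\<in>I. \<Sum>s\<in>J. p\<^sup>2 + p * (1 - p) * of_bool (r = s))"
    using R by (intro sum.cong refl mult(2)) auto
  also have "\<dots> = p\<^sup>2 * card I * card J + p * (1 - p) * (\<Sum>r\<in>I. \<Sum>s\<in>J. of_bool (r = s))"
    by (simp only: sum.distrib sum_constant flip: sum_distrib_left) simp
  also have "(\<Sum>r\<in>I. \<Sum>s\<in>J. of_bool (r = s)) = (\<Sum>r\<in>I. of_bool (r \<in> J))"
    using fin by (intro sum.cong refl) (auto simp: of_bool_def)
  also have "\<dots> = real (card (I \<inter> J))" using fin by simp
  finally show "expectation (\<lambda>\<omega>. (\<Sum>r\<in>I. Z r \<omega>) * (\<Sum>r\<in>J. Z r \<omega>)) =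
      p\<^sup>2 * card I * card J + p * (1 - p) * card (I \<inter> J)" .
qed

lemma cov_eq:
  assumes "integrable M X" "integrable M Y" "integrable M (\<lambda>\<omega>. X \<omega> * Y \<omega>)"
  shows "cov M X Y = expectation (\<lambda>\<omega>. X \<omega> * Y \<omega>) - expectation X * expectation Y"
proof -
  have "cov M X Y = expectation (\<lambda>\<omega>. X \<omega> * Y \<omega> - expectation Y * X \<omega> - expectation X * Y \<omega>
      + expectation X * expectation Y)"
    unfolding cov_def by (simp add: algebra_simps)
  also have "\<dots> = expectation (\<lambda>\<omega>. X \<omega> * Y \<omega>) - expectation X * expectation Y"
    using assms by (simp add: prob_space)
  finally show ?thesis .
qed

end

text \<open>Labelling each index by the member whose block contains it turns a partition into a
  multiset of members, the image of the labelling.\<close>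

lemma indexed_partition_label:
  assumes "indexed_partition U F A"
  obtains L where "\<And>r. r \<in> U \<Longrightarrow> L r \<in> F" "\<And>i. comp_set F A i = {r\<in>U. i \<in> L r}"
proof -
  have "\<exists>S\<in>F. r \<in> A S" if "r \<in> U" for r using assms that by (auto simp: indexed_partition_def)
  then obtain L where L: "\<And>r. r \<in> U \<Longrightarrow> L r \<in> F \<and> r \<in> A (L r)" by metis
  have uniq: "S = L r" if "S \<in> F" "r \<in> A S" "r \<in> U" for S r
    using assms that L[OF that(3)] unfolding indexed_partition_def disjoint_family_on_def by blast
  have "comp_set F A i = {r\<in>U. i \<in> L r}" for i
  proof -
    have "r \<in> U" if "S \<in> F" "r \<in> A S" for r S using assms that by (auto simp: indexed_partition_def)
    then show ?thesis unfolding comp_set_def using uniq L by blast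
  qed
  with L that show thesis by blast
qed

section \<open>Supermodular test functions\<close>

lemma supermodular_restrict:
  assumes "supermodular d \<Phi>"
  shows "supermodular_fun (\<lambda>x. \<Phi> (restrict x {1..d}))"
  unfolding supermodular_fun_def
proof (intro allI)
  fix x y :: "nat \<Rightarrow> real"
  have "restrict (inf x y) {1..d} = inf (restrict x {1..d}) (restrict y {1..d})"
    "restrict (sup x y) {1..d} = sup (restrict x {1..d}) (restrict y {1..d})"
    by (auto simp: restrict_def fun_eq_iff)
  then show "\<Phi> (restrict x {1..d}) + \<Phi> (restrict y {1..d})
      \<le> \<Phi> (restrict (inf x y) {1..d}) + \<Phi> (restrict (sup x y) {1..d})"
    using assms unfolding supermodular_def by simp
qed

text \<open>The factor may be negative: the values 1 and -1 together give equality of the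
  means.\<close>

lemma supermodular_coordinate: "supermodular d (\<lambda>x. c * x i)"
  unfolding supermodular_def by (auto simp: inf_real_def sup_real_def min_def max_def)

text \<open>When the two coordinates are ordered oppositely, the two sides differ by a product of
  two nonnegative differences; otherwise they are equal. With equal means this test function yields
  the covariance inequality.\<close>

lemma supermodular_product: "supermodular d (\<lambda>x. x i * x j)"
proof -
  have "a * b + c * e \<le> min a c * min b e + max a c * max b e" for a b c e :: real
  proof (cases "a \<le> c"; cases "b \<le> e")
    assume *: "a \<le> c" "\<not> b \<le> e"
    then have "0 \<le> (c - a) * (b - e)" by (intro mult_nonneg_nonneg) auto
    with * show ?thesis by (simp add: algebra_simps)
  next
    assume *: "\<not> a \<le> c" "b \<le> e"
    then have "0 \<le> (a - c) * (e - b)" by (intro mult_nonneg_nonneg) auto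
    with * show ?thesis by (simp add: algebra_simps)
  qed simp_all
  then show ?thesis unfolding supermodular_def by (auto simp: inf_real_def sup_real_def)
qed

context binary_tree_family begin

lemma trace_count_image_mset:
  assumes "P \<in> F" "finite R"
  shows "trace_count (image_mset L (mset_set R)) P = int (card {r\<in>R. P \<subseteq> L r})"
proof -
  have "trace_count (image_mset L (mset_set R)) P = (\<Sum>r\<in>R. of_bool (P \<subseteq> L r))"
    unfolding trace_count_def sum_unfold_sum_mset multiset.map_comp comp_def
      trace_of_mem[OF assms(1)] ..
  also have "\<dots> = int (card {r\<in>R. P \<subseteq> L r})"
    using assms(2) by (simp add: Collect_conj_eq)
  finally show ?thesis .
qed

end

theorem theorem3p1:
  fixes d n :: nat
    and e :: "nat \<Rightarrow> nat \<Rightarrow> nat set"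
    and M :: "'a measure"
    and Z :: "nat \<Rightarrow> 'a \<Rightarrow> real"
    and p :: real
    and A B :: "nat set \<Rightarrow> nat set"
    and XA XB :: "nat \<Rightarrow> 'a \<Rightarrow> real"
  assumes "d \<ge> 1" and "n \<ge> 1"
    and "binary_tree_assumption d e"
    and "prob_space M"
    and "0 \<le> p" and "p \<le> 1"
    and "prob_space.indep_vars M (\<lambda>_. borel) Z {1..n}"
    and "\<And>r. r \<in> {1..n} \<Longrightarrow> bernoulli_rv M p (Z r)"
    and "indexed_partition {1..n} (tree_family d e) A"
    and "indexed_partition {1..n} (tree_family d e) B"
    and "\<And>i \<omega>. XA i \<omega> = (\<Sum>r\<in>comp_set (tree_family d e) A i. Z r \<omega>)"
    and "\<And>i \<omega>. XB i \<omega> = (\<Sum>r\<in>comp_set (tree_family d e) B i. Z r \<omega>)"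
  shows "((\<forall>i\<in>{1..d}. (LINT \<omega>|M. XA i \<omega>) = (LINT \<omega>|M. XB i \<omega>)) \<and>
          (\<forall>i j. 1 \<le> i \<and> i < j \<and> j \<le> d \<longrightarrow> cov M (XA i) (XA j) \<le> cov M (XB i) (XB j)))
         \<longleftrightarrow> sm_le d M (\<lambda>\<omega>. \<lambda>i\<in>{1..d}. XA i \<omega>) M (\<lambda>\<omega>. \<lambda>i\<in>{1..d}. XB i \<omega>)"
proof -
  let ?R = "{1..n}" and ?F = "tree_family d e"
  interpret prob_space M by fact
  interpret binary_tree_family ?F by (rule binary_tree_family_tree_family) fact
  obtain K where K: "\<And>r. r \<in> ?R \<Longrightarrow> K r \<in> ?F" "\<And>i. comp_set ?F A i = {r\<in>?R. i \<in> K r}"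
    using indexed_partition_label[OF assms(9)] by metis
  obtain L where L: "\<And>r. r \<in> ?R \<Longrightarrow> L r \<in> ?F" "\<And>i. comp_set ?F B i = {r\<in>?R. i \<in> L r}"
    using indexed_partition_label[OF assms(10)] by metis
  define IA IB where "IA i = {r\<in>?R. i \<in> K r}" and "IB i = {r\<in>?R. i \<in> L r}" for i
  have XA: "XA i \<omega> = (\<Sum>r\<in>IA i. Z r \<omega>)" and XB: "XB i \<omega> = (\<Sum>r\<in>IB i. Z r \<omega>)" for i \<omega>
    by (simp_all add: assms(11,12) K(2) L(2) IA_def IB_def)
  have sub: "IA i \<subseteq> ?R" "IB i \<subseteq> ?R" for i by (auto simp: IA_def IB_def)
  note momA = bernoulli_sum_moments[OF assms(7) _ sub(1) sub(1) assms(8,5,6), folded XA, simplified]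
  note momB = bernoulli_sum_moments[OF assms(7) _ sub(2) sub(2) assms(8,5,6), folded XB, simplified]
  show ?thesis
  proof
    assume cond: "(\<forall>i\<in>{1..d}. (LINT \<omega>|M. XA i \<omega>) = (LINT \<omega>|M. XB i \<omega>)) \<and>
      (\<forall>i j. 1 \<le> i \<and> i < j \<and> j \<le> d \<longrightarrow> cov M (XA i) (XA j) \<le> cov M (XB i) (XB j))"
    let ?a = "image_mset K (mset_set ?R)" and ?b = "image_mset L (mset_set ?R)"
    have card_eq: "card (IA i) = card (IB i)" if "i \<in> {1..d}" "0 < p" for i
      using cond that momA(2)[of i] momB(2)[of i] by auto
    have mean_le: "bern_mean p f ?a (\<lambda>_. 0) \<le> bern_mean p f ?b (\<lambda>_. 0)"
      if f: "supermodular_fun f" and restr: "\<And>x. f (restrict x {1..d}) = f x" for f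
    proof -
      \<comment> \<open>For \<open>p\<close> equal to 0 or 1 all covariances vanish and say nothing
        about the cardinalities. The vector is then almost surely constant, and for
        \<open>p = 1\<close> the means determine it.\<close>
      consider "p = 0" | "p = 1" | "0 < p" "p < 1" using assms(5,6) by linarith
      then show ?thesis
      proof cases
        case 1
        then show ?thesis by (simp add: bern_mean_0)
      next
        case 2
        have "(\<Sum>S\<in>#?a. of_bool (i \<in> S)) = real (card (IA i))"
          "(\<Sum>S\<in>#?b. of_bool (i \<in> S)) = real (card (IB i))" for i
          unfolding multiset.map_comp comp_def sum_unfold_sum_mset[symmetric] IA_def IB_def
          by (simp_all add: Int_def)
        then have "bern_mean p f ?a (\<lambda>_. 0) = f (\<lambda>i. real (card (IA i)))"
          "bern_mean p f ?b (\<lambda>_. 0) = f (\<lambda>i. real (card (IB i)))"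
          using 2 by (simp_all add: bern_mean_1)
        \<comment> \<open>The cardinalities are compared only for \<open>i\<close> in
          \<open>{1..d}\<close>, which suffices as \<open>f\<close> ignores the other
          coordinates.\<close>
        moreover have "restrict (\<lambda>i. real (card (IA i))) {1..d} = restrict (\<lambda>i. real (card (IB i))) {1..d}"
          using card_eq 2 by (intro restrict_ext) auto
        ultimately show ?thesis by (metis order_refl restr)
      next
        case 3
        have pair: "card (IA i \<inter> IA j) \<le> card (IB i \<inter> IB j)" if ij: "1 \<le> i" "i < j" "j \<le> d" for i j
        proof -
          have "cov M (XA i) (XA j) = p * (1 - p) * card (IA i \<inter> IA j)"
            "cov M (XB i) (XB j) = p * (1 - p) * card (IB i \<inter> IB j)"
            by (simp_all add: cov_eq momA momB power2_eq_square)
          then have "p * (1 - p) * card (IA i \<inter> IA j) \<le> p * (1 - p) * card (IB i \<inter> IB j)"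
            using cond ij by metis
          then show ?thesis using 3 by (simp add: mult_le_cancel_left_pos)
        qed
        have node_eq: "{r\<in>?R. e k l \<subseteq> N r} = {r\<in>?R. k \<in> N r} \<inter> {r\<in>?R. l \<in> N r}"
          if kl: "1 \<le> k" "k < l" "l \<le> d" and N: "\<And>r. r \<in> ?R \<Longrightarrow> N r \<in> ?F" for k l N
        proof -
          have "k \<in> e k l" "l \<in> e k l"
            using assms(3) kl unfolding binary_tree_assumption_def by blast+
          moreover have "e k l \<subseteq> N r" if "r \<in> ?R" "k \<in> N r" "l \<in> N r" for r
            using tree_family_least[OF assms(3) kl N] that by blast
          ultimately show ?thesis by blast
        qed
        have sing: "trace_count ?a {i} = trace_count ?b {i}" if "{i} \<in> ?F" for i
        proof -
          have "i \<in> {1..d}" using that assms(3) unfolding binary_tree_assumption_def by blast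
          then show ?thesis using card_eq 3 that
            by (simp add: trace_count_image_mset IA_def IB_def)
        qed
        have "dominated_family ?F ?a ?b"
        proof
          show "set_mset ?a \<subseteq> ?F" "set_mset ?b \<subseteq> below" using K(1) L(1) mem_below by auto
          show "trace_count ?a {i} = trace_count ?b {i}" if "{i} \<in> ?F" for i using sing[OF that] .
          show "trace_count ?a P \<le> trace_count ?b P" if P: "P \<in> ?F" for P
            using assms(3) P
          proof (cases rule: tree_family_cases)
            case (leaf k)
            then show ?thesis using sing P by simp
          next
            case (node k l)
            have "card {r\<in>?R. P \<subseteq> K r} \<le> card {r\<in>?R. P \<subseteq> L r}"
              using pair[OF node(1-3)] node_eq[OF node(1-3)] K(1) L(1)
              unfolding node(4) IA_def IB_def by simp
            then show ?thesis using P by (simp add: trace_count_image_mset)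
          qed
        qed
        then show ?thesis using bern_mean_le[OF f assms(5,6)] by blast
      qed
    qed
    show "sm_le d M (\<lambda>\<omega>. \<lambda>i\<in>{1..d}. XA i \<omega>) M (\<lambda>\<omega>. \<lambda>i\<in>{1..d}. XB i \<omega>)"
      unfolding sm_le_def
    proof (intro allI impI, elim conjE)
      fix \<Phi>
      assume \<Phi>: "supermodular d \<Phi>" "integrable M (\<lambda>\<omega>. \<Phi> (\<lambda>i\<in>{1..d}. XA i \<omega>))"
        "integrable M (\<lambda>\<omega>. \<Phi> (\<lambda>i\<in>{1..d}. XB i \<omega>))"
      let ?f = "\<lambda>x. \<Phi> (restrict x {1..d})"
      have X: "XA i \<omega> = (\<Sum>r\<in>?R. Z r \<omega> * of_bool (i \<in> K r))"
        "XB i \<omega> = (\<Sum>r\<in>?R. Z r \<omega> * of_bool (i \<in> L r))" for i \<omega>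
        unfolding XA XB IA_def IB_def by (auto intro!: sum.mono_neutral_cong_left)
      have "expectation (\<lambda>\<omega>. \<Phi> (\<lambda>i\<in>{1..d}. XA i \<omega>)) = bern_mean p ?f ?a (\<lambda>_. 0)"
        using expectation_eq_bern_mean[OF _ _ assms(7,8,5,6), of ?f K] \<Phi>(2) assms(2)
        unfolding X by (simp add: borel_measurable_integrable)
      moreover have "expectation (\<lambda>\<omega>. \<Phi> (\<lambda>i\<in>{1..d}. XB i \<omega>)) = bern_mean p ?f ?b (\<lambda>_. 0)"
        using expectation_eq_bern_mean[OF _ _ assms(7,8,5,6), of ?f L] \<Phi>(3) assms(2)
        unfolding X by (simp add: borel_measurable_integrable)
      ultimately show "expectation (\<lambda>\<omega>. \<Phi> (\<lambda>i\<in>{1..d}. XA i \<omega>)) \<le> expectation (\<lambda>\<omega>. \<Phi> (\<lambda>i\<in>{1..d}. XB i \<omega>))"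
        using mean_le[OF supermodular_restrict[OF \<Phi>(1)]] by simp
    qed
  next
    assume "sm_le d M (\<lambda>\<omega>. \<lambda>i\<in>{1..d}. XA i \<omega>) M (\<lambda>\<omega>. \<lambda>i\<in>{1..d}. XB i \<omega>)"
    then have le: "expectation (\<lambda>\<omega>. \<Phi> (\<lambda>i\<in>{1..d}. XA i \<omega>)) \<le> expectation (\<lambda>\<omega>. \<Phi> (\<lambda>i\<in>{1..d}. XB i \<omega>))"
      if "supermodular d \<Phi>" "integrable M (\<lambda>\<omega>. \<Phi> (\<lambda>i\<in>{1..d}. XA i \<omega>))"
        "integrable M (\<lambda>\<omega>. \<Phi> (\<lambda>i\<in>{1..d}. XB i \<omega>))" for \<Phi>
      using that unfolding sm_le_def by blast
    have mean: "expectation (XA i) = expectation (XB i)" if "i \<in> {1..d}" for i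
      using le[OF supermodular_coordinate[of d 1 i]] le[OF supermodular_coordinate[of d "-1" i]]
        that momA(1)[of i] momB(1)[of i] by simp
    moreover have "cov M (XA i) (XA j) \<le> cov M (XB i) (XB j)" if ij: "1 \<le> i" "i < j" "j \<le> d" for i j
    proof -
      have "expectation (\<lambda>\<omega>. XA i \<omega> * XA j \<omega>) \<le> expectation (\<lambda>\<omega>. XB i \<omega> * XB j \<omega>)"
        using le[OF supermodular_product[of d i j]] ij momA(3)[of i j] momB(3)[of i j] by simp
      then show ?thesis
        using mean[of i] mean[of j] ij by (simp add: cov_eq momA(1,3) momB(1,3))
    qed
    ultimately show "(\<forall>i\<in>{1..d}. (LINT \<omega>|M. XA i \<omega>) = (LINT \<omega>|M. XB i \<omega>)) \<and>
      (\<forall>i j. 1 \<le> i \<and> i < j \<and> j \<le> d \<longrightarrow> cov M (XA i) (XA j) \<le> cov M (XB i) (XB j))" by blast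
  qed
qed

end
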